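(* Let $\mathcal{F}$ be any monotone class of graphs that is $\alpha$-ADT sketchable, for some $\alpha>1$. Then $\mathcal{F}$ has bounded expansion.
   Context: A class of graphs is a set of finite graphs closed under isomorphism; monotone means closed under subgraphs. $\mathcal{F}$ is $\alpha$-ADT sketchable if there is a constant $s$ such that for every $r\in\mathbb{N}$ there is a function $D_r:\{0,1\}^s\times\{0,1\}^s\to\{0,1\}$ such that for every $G\in\mathcal{F}$ there is a probability distribution over functions $\mathsf{sk}:V(G)\to\{0,1\}^{s}$ with, for all $x,y\in V(G)$: $\mathsf{dist}_G(x,y)\le r\Rightarrow\Pr[D_r(\mathsf{sk}(x),\mathsf{sk}(y))=1]\ge2/3$ and $\mathsf{dist}_G(x,y)>\alpha r\Rightarrow\Pr[D_r(\mathsf{sk}(x),\mathsf{sk}(y))=0]\ge2/3$ ($s$ independent of the number of vertices and of $r$). Bounded expansion: a depth-$r$ minor of $G$ is obtained from a subgraph of $G$ by contracting pairwise disjoint connected subgraphs of radius at most $r$; $\mathcal{F}$ has bounded expansion if there is a function $g$ such that every depth-$r$ minor of every graph of $\mathcal{F}$ has average degree at most $g(r)$. *)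

theory Defs
  imports
    "HOL-Probability.Probability_Mass_Function"
    "HOL-Library.FuncSet"
    "Graph_Theory.Graph_Theory"
begin

text \<open>
  Finite simple graphs are the \<^locale>\<open>pair_graph\<close>s of Graph\_Theory: finite vertex set, no
  loops, and a symmetric arc relation, so that an undirected edge is a pair of opposite arcs.
\<close>

definition graph_class :: "'a pair_pre_digraph set \<Rightarrow> bool" where
  "graph_class F \<longleftrightarrow>
     (\<forall>G\<in>F. pair_graph G) \<and>
     (\<forall>G\<in>F. \<forall>H. pair_graph H \<and> digraph_iso (with_proj G) (with_proj H) \<longrightarrow> H \<in> F)"

definition simple_subgraph :: "'a pair_pre_digraph \<Rightarrow> 'a pair_pre_digraph \<Rightarrow> bool" where
  "simple_subgraph H G \<longleftrightarrow> pair_graph H \<and> subgraph (with_proj H) (with_proj G)"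

definition monotone_class :: "'a pair_pre_digraph set \<Rightarrow> bool" where
  "monotone_class F \<longleftrightarrow> (\<forall>G\<in>F. \<forall>H. simple_subgraph H G \<longrightarrow> H \<in> F)"

text \<open>The distance between vertices in different components is \<open>\<infinity>\<close>.\<close>

definition graph_dist :: "'a pair_pre_digraph \<Rightarrow> 'a \<Rightarrow> 'a \<Rightarrow> ereal" where
  "graph_dist G x y = wf_digraph.\<mu> (with_proj G) (\<lambda>_. 1) x y"

definition graph_radius :: "'a pair_pre_digraph \<Rightarrow> ereal" where
  "graph_radius G = (INF c\<in>pverts G. SUP v\<in>pverts G. graph_dist G c v)"

definition adt_sketchable :: "real \<Rightarrow> 'a pair_pre_digraph set \<Rightarrow> bool" where
  "adt_sketchable \<alpha> F \<longleftrightarrow>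
     (\<exists>s::nat. \<forall>r::nat. \<exists>D :: bool list \<Rightarrow> bool list \<Rightarrow> bool. \<forall>G\<in>F.
        \<exists>p :: ('a \<Rightarrow> bool list) pmf.
          set_pmf p \<subseteq> pverts G \<rightarrow>\<^sub>E {w. length w = s} \<and>
          (\<forall>x\<in>pverts G. \<forall>y\<in>pverts G.
             (graph_dist G x y \<le> ereal (real r) \<longrightarrow>
                measure_pmf.prob p {sk. D (sk x) (sk y)} \<ge> 2 / 3) \<and>
             (graph_dist G x y > ereal (\<alpha> * real r) \<longrightarrow>
                measure_pmf.prob p {sk. \<not> D (sk x) (sk y)} \<ge> 2 / 3)))"

text \<open>
  Contraction of each graph of a family \<open>P\<close> of vertex-disjoint subgraphs of \<open>G\<close> to a single
  vertex, followed by removal of loops and parallel edges. A vertex of the result is the set of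
  vertices of \<open>G\<close> merged into it, which is a singleton for the vertices not covered by \<open>P\<close>.
\<close>

definition contract ::
  "'a pair_pre_digraph \<Rightarrow> 'a pair_pre_digraph set \<Rightarrow> 'a set pair_pre_digraph" where
  "contract G P =
     (let W = pverts ` P \<union> {{v} | v. v \<in> pverts G \<and> (\<forall>B\<in>P. v \<notin> pverts B)}
      in \<lparr> pverts = W,
           parcs = {(X, Y). X \<in> W \<and> Y \<in> W \<and> X \<noteq> Y \<and> (\<exists>x\<in>X. \<exists>y\<in>Y. (x, y) \<in> parcs G)} \<rparr>)"

definition depth_minor ::
  "nat \<Rightarrow> 'a set pair_pre_digraph \<Rightarrow> 'a pair_pre_digraph \<Rightarrow> bool" where
  "depth_minor r H G \<longleftrightarrow>
     (\<exists>G' P. simple_subgraph G' G \<and>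
        (\<forall>B\<in>P. simple_subgraph B G' \<and> Digraph_Component.connected (with_proj B) \<and>
           graph_radius B \<le> ereal (real r)) \<and>
        pairwise (\<lambda>B C. disjnt (pverts B) (pverts C)) P \<and>
        H = contract G' P)"

text \<open>Out-degree is degree for symmetric digraphs. The graph without vertices gets value 0.\<close>

definition average_degree :: "'a pair_pre_digraph \<Rightarrow> real" where
  "average_degree G =
     (\<Sum>v\<in>pverts G. real (out_degree (with_proj G) v)) / real (card (pverts G))"

definition bounded_expansion :: "'a pair_pre_digraph set \<Rightarrow> bool" where
  "bounded_expansion F \<longleftrightarrow>
     (\<exists>g :: nat \<Rightarrow> real. \<forall>r. \<forall>G\<in>F. \<forall>H. depth_minor r H G \<longrightarrow> average_degree H \<le> g r)"

end

theory Submission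
  imports Defs
begin

text \<open>
  Suppose some depth-\<open>r\<close> minors \<open>H\<close> of members of the class have unbounded average degree. The number
  of bits \<open>s\<close> of a sketch does not depend on the distance threshold, so it is enough to find in \<open>H\<close>
  a graph \<open>Q\<close> of average degree large in terms of \<open>s\<close> and of girth larger than
  \<open>t = \<alpha> (2 r + 1)\<close>, every edge of which is subdivided the same (arbitrary) number of times: deleting
  an edge of \<open>Q\<close> pushes the distance of its ends from at most \<open>\<rho> = l (2 r + 1)\<close> above \<open>\<alpha> \<rho>\<close> in the
  corresponding subgraph of \<open>G\<close>, so the sketches for the threshold \<open>\<rho>\<close> encode all
  \<open>2 ^ card Q\<close> subgraphs of \<open>Q\<close> by labellings of its vertices with \<open>s\<close> bits, up to a third of wrong
  edges, and there are not enough labellings.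

  To find \<open>Q\<close>, start from a bipartite subgraph with parts \<open>A\<close>, \<open>B\<close>, where \<open>card A \<le> card B\<close> and
  the vertices of \<open>B\<close> have many neighbours in \<open>A\<close>. Pack stars with \<open>C\<close> leaves centred in \<open>B\<close> greedily,
  keeping degrees bounded and the girth large. If the packing stops before it is dense, then most
  vertices of \<open>B\<close> send half of their edges into the small set of saturated vertices of \<open>A\<close>. After some
  repetitions \<open>B\<close> is much larger than \<open>A\<close>, and using its vertices as subdivision vertices yields either a
  clique or a graph on \<open>A\<close> as dense as \<open>H\<close> with fewer vertices, to which the argument applies again.
\<close>

section \<open>Walks of bounded length and girth\<close>

text \<open>Standing still counts as a step, so this is distance at most \<open>k\<close> and grows
  with \<open>k\<close>. Graphs are bare sets of unordered edges, so adding, deleting and projecting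
  edges are plain set operations.\<close>

primrec reach :: "'v set set \<Rightarrow> nat \<Rightarrow> 'v \<Rightarrow> 'v \<Rightarrow> bool" where
  "reach E 0 x y \<longleftrightarrow> x = y"
| "reach E (Suc k) x y \<longleftrightarrow> (\<exists>z. reach E k x z \<and> (z = y \<or> {z, y} \<in> E))"

lemma reach_refl [simp]: "reach E k x x"
  by (induction k) auto

lemma reach_step: "reach E k x z \<Longrightarrow> {z, y} \<in> E \<Longrightarrow> reach E (Suc k) x y"
  by auto

lemma reach_mono:
  assumes "reach E k x y" "E \<subseteq> E'" "k \<le> l"
  shows "reach E' l x y"
proof -
  have "reach E' k x y"
    using assms(1,2) by (induction k arbitrary: y) auto
  then show ?thesis
    using assms(3) by (induction l) (auto simp: le_Suc_eq)
qed

lemma reach_trans: "reach E k x y \<Longrightarrow> reach E l y z \<Longrightarrow> reach E (k + l) x z"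
  by (induction l arbitrary: z) auto

lemma reach_edge: "{x, y} \<in> E \<Longrightarrow> reach E (Suc 0) x y"
  by auto

lemma reach_sym: "reach E k x y \<Longrightarrow> reach E k y x"
proof (induction k arbitrary: y)
  case (Suc k)
  then obtain z where z: "reach E k x z" "z = y \<or> {z, y} \<in> E" by auto
  from Suc.IH[OF z(1)] have zx: "reach E k z x" .
  show ?case
  proof (cases "z = y")
    case True
    then show ?thesis using zx by auto
  next
    case False
    then have "{y, z} \<in> E" using z(2) by (simp add: insert_commute)
    then have "reach E (Suc 0 + k) y x" by (intro reach_trans[OF _ zx] reach_edge)
    then show ?thesis by simp
  qed
qed auto

definition nbs :: "'v set set \<Rightarrow> 'v set \<Rightarrow> 'v \<Rightarrow> 'v set" where
  "nbs E A v = {a \<in> A. {a, v} \<in> E}"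

lemma finite_nbs [intro]: "finite A \<Longrightarrow> finite (nbs E A v)"
  by (simp add: nbs_def)

text \<open>Each step enlarges a ball by a factor of at most \<open>1 + \<Delta>\<close>. The bound
  limits how many candidates one chosen leaf of a new star can exclude.\<close>

lemma card_ball_reach_le:
  assumes "finite S" "\<And>v. card {e \<in> S. v \<in> e} \<le> \<Delta>"
  shows "finite {y. reach S k x y} \<and> card {y. reach S k x y} \<le> (1 + \<Delta>) ^ k"
proof (induction k)
  case 0
  have "{y. reach S 0 x y} = {x}" by auto
  then show ?case by simp
next
  case (Suc k)
  define N where "N z = {y. {z, y} \<in> S}" for z
  have N: "finite (N z) \<and> card (N z) \<le> \<Delta>" for z
  proof -
    have inj: "inj_on (\<lambda>y. {z, y}) (N z)"
      by (auto simp: inj_on_def doubleton_eq_iff)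
    have sub: "(\<lambda>y. {z, y}) ` N z \<subseteq> {e \<in> S. z \<in> e}"
      by (auto simp: N_def)
    have fin: "finite {e \<in> S. z \<in> e}" using assms(1) by simp
    show ?thesis
      using inj_on_finite[OF inj sub fin] card_inj_on_le[OF inj sub fin] assms(2)[of z] by simp
  qed
  let ?B = "{y. reach S k x y}"
  have eq: "{y. reach S (Suc k) x y} = (\<Union>z\<in>?B. insert z (N z))"
    by (auto simp: N_def)
  have "card (insert z (N z)) \<le> 1 + \<Delta>" for z
    using N[of z] by (simp add: card_insert_if)
  then have "card (\<Union>z\<in>?B. insert z (N z)) \<le> (\<Sum>z\<in>?B. 1 + \<Delta>)"
    using Suc by (intro order.trans[OF card_UN_le] sum_mono) auto
  also have "\<dots> = card ?B * (1 + \<Delta>)"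
    by simp
  also have "\<dots> \<le> (1 + \<Delta>) ^ k * (1 + \<Delta>)"
    using Suc by (intro mult_right_mono) auto
  also have "\<dots> = (1 + \<Delta>) ^ Suc k"
    by (rule power_Suc2[symmetric])
  finally show ?case
    using eq N Suc by simp
qed

text \<open>
  Girth is expressed through the distance of the ends of a deleted edge, which is how it is used:
  the cycle through the edge has length at least \<open>t + 2\<close>.
\<close>

definition girth_gt :: "nat \<Rightarrow> 'v set set \<Rightarrow> bool" where
  "girth_gt t E \<longleftrightarrow> (\<forall>x y. {x, y} \<in> E \<longrightarrow> \<not> reach (E - {{x, y}}) t x y)"

definition star :: "'v \<Rightarrow> 'v set \<Rightarrow> 'v set set" where
  "star b N = (\<lambda>a. {b, a}) ` N"

text \<open>The new vertex \<open>b\<close> is entered and left only through leaves. In a walk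
  through \<open>b\<close>, \<open>a\<close> is the leaf of the first entry and \<open>c\<close>
  that of the last exit; the two extra steps are the edges at \<open>b\<close>. If these leaves
  coincide, the detour is cut out and the walk stays in \<open>S\<close>.\<close>

lemma reach_Un_star:
  assumes "reach (S \<union> star b N) k x y" "b \<notin> \<Union>S" "b \<notin> N" "x \<noteq> b"
  shows "(y = b \<longrightarrow> (\<exists>a\<in>N. \<exists>l. Suc l \<le> k \<and> reach S l x a)) \<and>
    (y \<noteq> b \<longrightarrow> reach S k x y \<or>
      (\<exists>a\<in>N. \<exists>c\<in>N. \<exists>l m. a \<noteq> c \<and> Suc (Suc (l + m)) \<le> k \<and> reach S l x a \<and> reach S m c y))"
proof -
  define Q where "Q k y \<longleftrightarrow> reach S k x y \<or>
      (\<exists>a\<in>N. \<exists>c\<in>N. \<exists>l m. a \<noteq> c \<and> Suc (Suc (l + m)) \<le> k \<and> reach S l x a \<and> reach S m c y)" for k y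
  define P where "P k \<longleftrightarrow> (\<exists>a\<in>N. \<exists>l. Suc l \<le> k \<and> reach S l x a)" for k
  have Q1: "Q (Suc k) y" if "Q k y" for k y
    using that le_SucI unfolding Q_def by (meson reach_mono order_refl le_SucI)
  have Q2: "Q (Suc k) y" if "Q k z" "{z, y} \<in> S" for k y z
    using that(1) unfolding Q_def
  proof (elim disjE bexE exE conjE)
    assume "reach S k x z"
    then show "reach S (Suc k) x y \<or> (\<exists>a\<in>N. \<exists>c\<in>N. \<exists>l m. a \<noteq> c \<and>
      Suc (Suc (l + m)) \<le> Suc k \<and> reach S l x a \<and> reach S m c y)"
      using that(2) by (intro disjI1 reach_step)
  next
    fix a c l m
    assume *: "a \<in> N" "c \<in> N" "a \<noteq> c" "Suc (Suc (l + m)) \<le> k" "reach S l x a" "reach S m c z"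
    have "reach S (Suc m) c y" using *(6) that(2) by (rule reach_step)
    moreover have "Suc (Suc (l + Suc m)) \<le> Suc k" using * by simp
    ultimately show "reach S (Suc k) x y \<or> (\<exists>a\<in>N. \<exists>c\<in>N. \<exists>l m. a \<noteq> c \<and>
      Suc (Suc (l + m)) \<le> Suc k \<and> reach S l x a \<and> reach S m c y)"
      using *(1,2,3,5) by blast
  qed
  have Q3: "Q (Suc k) y" if P: "P k" and y: "y \<in> N" for k y
  proof -
    obtain a l where al: "a \<in> N" "Suc l \<le> k" "reach S l x a" using P P_def by auto
    show ?thesis
    proof (cases "a = y")
      case True
      then show ?thesis using al unfolding Q_def by (meson reach_mono Suc_leD le_SucI order_refl)
    next
      case False
      have "Suc (Suc (l + 0)) \<le> Suc k" "reach S 0 y y" using al by auto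
      then show ?thesis using False al(1,3) y unfolding Q_def by blast
    qed
  qed
  have P1: "P (Suc k)" if "P k" for k
    using that unfolding P_def by (meson le_SucI)
  \<comment> \<open>On a return to \<open>b\<close>, everything after the first entry is forgotten:
    its leaf is still a witness.\<close>
  have P2: "P (Suc k)" if "Q k z" "z \<in> N" for k z
    using that(1) unfolding Q_def
  proof (elim disjE bexE exE conjE)
    assume "reach S k x z"
    then show ?thesis using that(2) unfolding P_def by blast
  next
    fix a c l m
    assume *: "a \<in> N" "Suc (Suc (l + m)) \<le> k" "reach S l x a"
    then have "Suc l \<le> Suc k" by simp
    then show ?thesis using * unfolding P_def by blast
  qed
  have "(y = b \<longrightarrow> P k) \<and> (y \<noteq> b \<longrightarrow> Q k y)"
    using assms(1)
  proof (induction k arbitrary: y)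
    case 0
    then show ?case using assms(4) by (auto simp: Q_def)
  next
    case (Suc k)
    then obtain z where z: "reach (S \<union> star b N) k x z" "z = y \<or> {z, y} \<in> S \<union> star b N" by auto
    note IH = Suc.IH[OF z(1)]
    consider "z = y" | "{z, y} \<in> S" "z \<noteq> b" "y \<noteq> b" | "z = b" "y \<in> N" | "y = b" "z \<in> N"
      using z(2) assms(2) by (auto simp: star_def doubleton_eq_iff)
    then show ?case
      by cases (use IH assms(3) Q1 Q2 Q3 P1 P2 in blast)+
  qed
  then show ?thesis unfolding P_def Q_def .
qed

text \<open>A short cycle created by the star passes through \<open>b\<close>, hence through two
  distinct leaves. The rest of the cycle joins these leaves inside \<open>S\<close>, which
  \<open>far\<close> forbids.\<close>

lemma girth_gt_Un_star:
  assumes g: "girth_gt t S" and b: "b \<notin> \<Union>S" "b \<notin> N"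
    and far: "\<And>a c. a \<in> N \<Longrightarrow> c \<in> N \<Longrightarrow> a \<noteq> c \<Longrightarrow> \<not> reach S t a c"
  shows "girth_gt t (S \<union> star b N)"
  unfolding girth_gt_def
proof (intro allI impI notI)
  fix x y
  assume e: "{x, y} \<in> S \<union> star b N" and w: "reach (S \<union> star b N - {{x, y}}) t x y"
  have new: False if "a \<in> N" and w: "reach (S \<union> star b N - {{b, a}}) t a b" for a
  proof -
    have "S \<union> star b N - {{b, a}} \<subseteq> S \<union> star b (N - {a})"
      unfolding star_def by blast
    then have w: "reach (S \<union> star b (N - {a})) t a b"
      by (rule reach_mono[OF w]) simp
    have "a \<noteq> b" using \<open>a \<in> N\<close> b by blast
    have "b \<notin> N - {a}" using b by auto
    from reach_Un_star[OF w b(1) this \<open>a \<noteq> b\<close>]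
    obtain c l where c: "c \<in> N - {a}" "Suc l \<le> t" "reach S l a c"
      by blast
    from c(3) have "reach S t a c" by (rule reach_mono) (use c(2) in auto)
    then show False
      using far[of a c] \<open>a \<in> N\<close> c(1) by blast
  qed
  show False
  proof (cases "{x, y} \<in> S")
    case True
    let ?S = "S - {{x, y}}"
    have xb: "x \<noteq> b" "y \<noteq> b" "b \<notin> \<Union>?S" using True b by blast+
    have "S \<union> star b N - {{x, y}} \<subseteq> ?S \<union> star b N" by auto
    then have w: "reach (?S \<union> star b N) t x y" by (rule reach_mono[OF w]) simp
    have "\<not> reach ?S t x y" using g True unfolding girth_gt_def by blast
    then obtain a c l m where ac: "a \<in> N" "c \<in> N" "a \<noteq> c" "Suc (Suc (l + m)) \<le> t"
      "reach ?S l x a" "reach ?S m c y"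
      using reach_Un_star[OF w xb(3) b(2) xb(1)] xb(2) by blast
    have ax: "reach S l a x"
      by (rule reach_mono[OF reach_sym[OF ac(5)]]) auto
    have yc: "reach S m y c"
      by (rule reach_mono[OF reach_sym[OF ac(6)]]) auto
    \<comment> \<open>The other way round the cycle, over the deleted edge \<open>{x, y}\<close>:
      the two steps through \<open>b\<close> are traded for one.\<close>
    have "reach S (l + Suc 0 + m) a c"
      using reach_trans[OF reach_trans[OF ax reach_edge[OF True]] yc] .
    moreover have "l + Suc 0 + m \<le> t" using ac(4) by simp
    ultimately have "reach S t a c" by (rule reach_mono[OF _ order_refl])
    then show False using far ac by blast
  next
    case False
    then obtain a where a: "a \<in> N" "{x, y} = {b, a}" using e by (auto simp: star_def)
    then consider "x = b" "y = a" | "x = a" "y = b" by (auto simp: doubleton_eq_iff)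
    then show False
    proof cases
      case 1
      then have "reach (S \<union> star b N - {{b, a}}) t a b" using reach_sym[OF w] by simp
      then show False using new a by blast
    next
      case 2
      then have "reach (S \<union> star b N - {{b, a}}) t a b" using w by (simp add: insert_commute)
      then show False using new a by blast
    qed
  qed
qed

text \<open>Greedy choice: each chosen element discards the at most \<open>Y\<close> elements
  related to it, so \<open>C * Y\<close> elements last for \<open>C\<close> rounds. \<open>R\<close>
  will be nearness in the current packing.\<close>

lemma exists_pairwise_far:
  assumes "finite U" "C * Y \<le> card U" "0 < Y"
    and sym: "\<And>x y. R x y \<Longrightarrow> R y x" and refl: "\<And>x. R x x"
    and ball: "\<And>x. card {y \<in> U. R x y} \<le> Y"
  shows "\<exists>N\<subseteq>U. card N = C \<and> (\<forall>a\<in>N. \<forall>c\<in>N. a \<noteq> c \<longrightarrow> \<not> R a c)"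
  using assms(1,2) ball
proof (induction C arbitrary: U)
  case 0
  then show ?case by (intro exI[of _ "{}"]) auto
next
  case (Suc C)
  show ?case
  proof (cases "U = {}")
    case True
    then show ?thesis using Suc.prems assms(3) by simp
  next
    case False
    then obtain x where x: "x \<in> U" by auto
    define U' where "U' = U - {y \<in> U. R x y}"
    have "card U' = card U - card {y \<in> U. R x y}"
      using Suc.prems(1) unfolding U'_def by (intro card_Diff_subset) auto
    then have c: "C * Y \<le> card U'" using Suc.prems(2) Suc.prems(3)[of x] by simp
    have "card {y \<in> U'. R z y} \<le> Y" for z
      using Suc.prems(1) by (intro order.trans[OF card_mono Suc.prems(3)[of z]]) (auto simp: U'_def)
    then obtain N where N: "N \<subseteq> U'" "card N = C" "\<forall>a\<in>N. \<forall>c\<in>N. a \<noteq> c \<longrightarrow> \<not> R a c"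
      using Suc.IH[of U'] c Suc.prems(1) by (auto simp: U'_def)
    have "x \<notin> N" using N(1) refl by (auto simp: U'_def)
    moreover have "finite N" using N(1) Suc.prems(1) by (auto simp: U'_def intro: finite_subset)
    ultimately have "card (insert x N) = Suc C" using N(2) by simp
    moreover have "\<forall>a\<in>insert x N. \<forall>c\<in>insert x N. a \<noteq> c \<longrightarrow> \<not> R a c"
      using N sym by (auto simp: U'_def)
    moreover have "insert x N \<subseteq> U" using N(1) x by (auto simp: U'_def)
    ultimately show ?thesis by blast
  qed
qed

section \<open>Packing stars\<close>

text \<open>The factor \<open>3\<close>: a packing of \<open>m\<close> stars is dense as soon as \<open>card A \<le> 2 * m\<close>.\<close>

definition dense_girth :: "nat \<Rightarrow> nat \<Rightarrow> 'v set \<Rightarrow> 'v set set \<Rightarrow> bool" where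
  "dense_girth C t V E \<longleftrightarrow> V \<noteq> {} \<and> finite V \<and> (\<forall>e\<in>E. e \<subseteq> V \<and> card e = 2) \<and>
     girth_gt t E \<and> C * card V \<le> 3 * card E"

lemma card_star: "card (star b N) = card N"
  unfolding star_def by (rule card_image) (auto simp: inj_on_def doubleton_eq_iff)

lemma star_packing:
  fixes C t :: nat and E :: "'v set set"
  assumes fin: "finite A" "finite B" and disj: "A \<inter> B = {}" and B: "B \<noteq> {}" and AB: "card A \<le> card B"
    and C: "0 < C" and deg: "\<And>b. b \<in> B \<Longrightarrow> 2 * (C * (1 + 16 * C) ^ t) \<le> card (nbs E A b)"
    and no: "\<not> (\<exists>V F. F \<subseteq> E \<and> V \<subseteq> A \<union> B \<and> dense_girth C t V F)"
  shows "\<exists>A'\<subseteq>A. \<exists>B'\<subseteq>B. 16 * card A' \<le> card A \<and> card B \<le> 2 * card B' \<and>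
    (\<forall>b\<in>B'. card (nbs E A b) \<le> 2 * card (nbs E A' b))"
proof -
  \<comment> \<open>\<open>T\<close> holds the centres and \<open>S\<close> the edges of the stars,
    whose shape is remembered only through the count \<open>card S = C * card T\<close>. The degree
    cap \<open>16 * C\<close> both bounds the balls and makes saturated vertices few.\<close>
  define ok where "ok S T \<longleftrightarrow> T \<subseteq> B \<and> S \<subseteq> E \<and> (\<forall>e\<in>S. \<exists>a\<in>A. \<exists>b\<in>T. e = {a, b}) \<and>
    card S = C * card T \<and> (\<forall>v. card {e \<in> S. v \<in> e} \<le> 16 * C) \<and> girth_gt t S" for S T
  have "ok {} {}" by (auto simp: ok_def girth_gt_def)
  moreover have "card T < Suc (card B)" if "ok S T" for S T
    using that card_mono[OF fin(2)] by (auto simp: ok_def less_Suc_eq_le)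
  ultimately obtain S T where ST: "ok S T" and max: "\<And>S' T'. ok S' T' \<Longrightarrow> card T' \<le> card T"
    using ex_has_greatest_nat[of "\<lambda>p. ok (fst p) (snd p)" "({}, {})" "\<lambda>p. card (snd p)" "Suc (card B)"]
    by auto
  have T: "T \<subseteq> B" and SE: "S \<subseteq> E" and S: "\<And>e. e \<in> S \<Longrightarrow> \<exists>a\<in>A. \<exists>b\<in>T. e = {a, b}"
    and cS: "card S = C * card T" and dS: "\<And>v. card {e \<in> S. v \<in> e} \<le> 16 * C" and gS: "girth_gt t S"
    using ST by (auto simp: ok_def)
  have finT: "finite T" using T fin finite_subset by blast
  have finS: "finite S"
    by (rule finite_subset[of _ "(\<lambda>(a, b). {a, b}) ` (A \<times> T)"]) (use S finT fin in auto)
  have Ane: "A \<noteq> {}"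
  proof
    assume "A = {}"
    moreover from B obtain b where "b \<in> B" by auto
    ultimately show False using deg[of b] C by (simp add: nbs_def)
  qed
  show ?thesis
  proof (cases "card A \<le> 2 * card T")
    case True
    have "card (A \<union> T) \<le> 3 * card T" using card_Un_le[of A T] True by simp
    then have "C * card (A \<union> T) \<le> C * (3 * card T)" by (rule mult_le_mono2)
    moreover have "e \<subseteq> A \<union> T \<and> card e = 2" if "e \<in> S" for e
      using S[OF that] T disj by (auto simp: card_insert_if)
    ultimately have "dense_girth C t (A \<union> T) S"
      using Ane fin finT gS cS by (auto simp: dense_girth_def)
    moreover have "A \<union> T \<subseteq> A \<union> B" using T by blast
    ultimately have "\<exists>V F. F \<subseteq> E \<and> V \<subseteq> A \<union> B \<and> dense_girth C t V F"
      using SE by (intro exI[of _ "A \<union> T"] exI[of _ S] conjI)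
    with no show ?thesis by contradiction
  next
    case False
    \<comment> \<open>The saturated vertices. An edge of \<open>S\<close> has only one end in
      \<open>A\<close>, so their edge sets are disjoint and each of them uses up
      \<open>16 * C\<close> edges of \<open>S\<close>.\<close>
    define A' where "A' = {a \<in> A. 16 * C \<le> card {e \<in> S. a \<in> e}}"
    have "16 * C * card A' = (\<Sum>a\<in>A'. 16 * C)" by simp
    also have "\<dots> \<le> (\<Sum>a\<in>A'. card {e \<in> S. a \<in> e})"
      by (rule sum_mono) (simp add: A'_def)
    also have "\<dots> = card (\<Union>a\<in>A'. {e \<in> S. a \<in> e})"
    proof (rule card_UN_disjoint[symmetric])
      show "finite A'" "\<forall>a\<in>A'. finite {e \<in> S. a \<in> e}" using fin finS by (auto simp: A'_def)
      have "a = a'" if "a \<in> A" "a' \<in> A" "e \<in> S" "a \<in> e" "a' \<in> e" for a a' e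
        using S[OF that(3)] that disj T by auto
      then show "\<forall>a\<in>A'. \<forall>a'\<in>A'. a \<noteq> a' \<longrightarrow> {e \<in> S. a \<in> e} \<inter> {e \<in> S. a' \<in> e} = {}"
        unfolding A'_def by blast
    qed
    also have "\<dots> \<le> card S" by (rule card_mono) (use finS in auto)
    finally have "C * (16 * card A') \<le> C * card T" using cS by simp
    then have A'T: "16 * card A' \<le> card T" using C by simp
    have cB: "card (B - T) = card B - card T" by (rule card_Diff_subset[OF finT T])
    have "card (nbs E A b) \<le> 2 * card (nbs E A' b)" if b: "b \<in> B - T" for b
    proof (rule ccontr)
      assume less: "\<not> ?thesis"
      \<comment> \<open>More than half of the neighbours are unsaturated, so the factor 2 in
        \<open>deg\<close> leaves enough of them to pick \<open>C\<close> pairwise far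
        leaves.\<close>
      define U where "U = nbs E A b - A'"
      have "nbs E A b \<subseteq> nbs E A' b \<union> U" by (auto simp: nbs_def U_def)
      moreover have finU: "finite U" "finite (nbs E A' b)" using fin by (auto simp: U_def A'_def)
      ultimately have "card (nbs E A b) \<le> card (nbs E A' b) + card U"
        by (meson card_Un_le card_mono finite_UnI order.trans)
      then have "C * (1 + 16 * C) ^ t \<le> card U" using less deg[of b] b by simp
      moreover have "card {y \<in> U. reach S t x y} \<le> (1 + 16 * C) ^ t" for x
      proof -
        have "finite {y. reach S t x y}" "card {y. reach S t x y} \<le> (1 + 16 * C) ^ t"
          using card_ball_reach_le[OF finS dS] by auto
        moreover from this have "card {y \<in> U. reach S t x y} \<le> card {y. reach S t x y}"
          by (intro card_mono) auto
        ultimately show ?thesis by simp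
      qed
      ultimately obtain N where N: "N \<subseteq> U" "card N = C"
        and far: "\<And>a c. a \<in> N \<Longrightarrow> c \<in> N \<Longrightarrow> a \<noteq> c \<Longrightarrow> \<not> reach S t a c"
      proof -
        assume *: "C * (1 + 16 * C) ^ t \<le> card U"
          "\<And>x. card {y \<in> U. reach S t x y} \<le> (1 + 16 * C) ^ t"
        have "0 < (1 + 16 * C) ^ t" by simp
        from exists_pairwise_far[OF finU(1) *(1) this reach_sym reach_refl *(2)]
        show ?thesis using that by blast
      qed
      have NA: "N \<subseteq> A" using N by (auto simp: U_def nbs_def)
      have bS: "b \<notin> \<Union>S" using S b disj by blast
      have bN: "b \<notin> N" using NA b disj by blast
      have finN: "finite N" using NA fin finite_subset by blast
      have "ok (S \<union> star b N) (insert b T)"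
        unfolding ok_def
      proof (intro conjI ballI allI)
        show "insert b T \<subseteq> B" using b T by auto
        show "S \<union> star b N \<subseteq> E"
          using SE N(1) by (auto simp: star_def U_def nbs_def insert_commute)
        fix e assume e: "e \<in> S \<union> star b N"
        show "\<exists>a\<in>A. \<exists>b'\<in>insert b T. e = {a, b'}"
        proof (cases "e \<in> S")
          case True
          then show ?thesis using S by blast
        next
          case False
          then obtain a where "a \<in> N" "e = {b, a}" using e by (auto simp: star_def)
          then show ?thesis using NA by (intro bexI[of _ a] bexI[of _ b]) auto
        qed
      next
        have "S \<inter> star b N = {}" using bS by (auto simp: star_def)
        then show "card (S \<union> star b N) = C * card (insert b T)"
          using card_Un_disjoint[of S "star b N"] b finS finN finT N(2) cS card_star[of b N]
          by (simp add: star_def)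
      next
        fix v
        let ?new = "{e \<in> star b N. v \<in> e}"
        have eq: "{e \<in> S \<union> star b N. v \<in> e} = {e \<in> S. v \<in> e} \<union> ?new" by blast
        have le: "card {e \<in> S \<union> star b N. v \<in> e} \<le> card {e \<in> S. v \<in> e} + card ?new"
          unfolding eq by (rule card_Un_le)
        consider "v = b" | "v \<in> N" | "v \<noteq> b" "v \<notin> N" by blast
        then show "card {e \<in> S \<union> star b N. v \<in> e} \<le> 16 * C"
        proof cases
          case 1
          then have "card {e \<in> S. v \<in> e} = 0" using bS by (auto simp: card_eq_0_iff)
          moreover have "card ?new \<le> card (star b N)"
            by (rule card_mono) (use finN in \<open>auto simp: star_def\<close>)
          ultimately show ?thesis using le N(2) card_star[of b N] by linarith
        next
          case 2
          then have "?new \<subseteq> {{b, v}}" using bN by (auto simp: star_def)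
          then have "card ?new \<le> 1" using card_mono[of "{{b, v}}" ?new] by simp
          \<comment> \<open>Leaves are unsaturated, so there is room for the single new
            edge.\<close>
          moreover have "v \<in> A" "v \<notin> A'" using 2 N(1) NA by (auto simp: U_def)
          then have "card {e \<in> S. v \<in> e} < 16 * C" by (simp add: A'_def)
          ultimately show ?thesis using le by linarith
        next
          case 3
          then have "card ?new = 0" by (auto simp: card_eq_0_iff star_def)
          then show ?thesis using le dS[of v] by linarith
        qed
      next
        show "girth_gt t (S \<union> star b N)"
          by (rule girth_gt_Un_star[OF gS bS bN far])
      qed
      from max[OF this] show False using b finT by simp
    qed
    moreover have "card B \<le> 2 * card (B - T)" "16 * card A' \<le> card A"
      using cB False AB A'T by simp_all
    moreover have "A' \<subseteq> A" by (auto simp: A'_def)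
    ultimately show ?thesis
      by (intro exI[of _ A'] exI[of _ "B - T"] conjI ballI) auto
  qed
qed

text \<open>Iterates \<open>star_packing\<close>. A round divides \<open>A\<close> by at least 16
  and \<open>B\<close> by at most 2, so the ratio \<open>\<beta>\<close> gains a factor 8, while
  degrees into the surviving part of \<open>A\<close> at most halve. The fixed set \<open>X\<close>
  lets every round inherit the assumption \<open>no\<close>.\<close>

lemma unbalanced_of_no_dense_girth:
  fixes C t :: nat and E :: "'v set set"
  assumes C: "0 < C" and D: "2 * (C * (1 + 16 * C) ^ t) \<le> D"
    and no: "\<not> (\<exists>V F. F \<subseteq> E \<and> V \<subseteq> X \<and> dense_girth C t V F)"
    and "finite A" "finite B" "A \<inter> B = {}" "B \<noteq> {}" "A \<union> B \<subseteq> X" "0 < \<beta>" "\<beta> * card A \<le> card B"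
    and "\<And>b. b \<in> B \<Longrightarrow> 2 ^ k * D \<le> card (nbs E A b)"
  shows "\<exists>A'\<subseteq>A. \<exists>B'\<subseteq>B. B' \<noteq> {} \<and> 8 ^ k * \<beta> * card A' \<le> card B' \<and> (\<forall>b\<in>B'. D \<le> card (nbs E A' b))"
  using assms(4-)
proof (induction k arbitrary: A B \<beta>)
  case 0
  then show ?case by (intro exI[of _ A] exI[of _ B] conjI) auto
next
  case (Suc k)
  have deg: "2 * (C * (1 + 16 * C) ^ t) \<le> card (nbs E A b)" if "b \<in> B" for b
  proof -
    have "D * 1 \<le> D * 2 ^ Suc k" by (intro mult_le_mono) auto
    then have "D \<le> 2 ^ Suc k * D" by (simp add: mult.commute)
    then show ?thesis using D Suc.prems(8)[OF that] by linarith
  qed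
  have AB: "card A \<le> card B"
    using Suc.prems(6,7) by (metis One_nat_def Suc_leI mult_le_mono1 nat_mult_1 order.trans)
  have "\<not> (\<exists>V F. F \<subseteq> E \<and> V \<subseteq> A \<union> B \<and> dense_girth C t V F)"
    using no Suc.prems(5) by (meson order.trans)
  from star_packing[OF Suc.prems(1-4) AB C deg this]
  obtain A' B' where A'B': "A' \<subseteq> A" "B' \<subseteq> B" "16 * card A' \<le> card A" "card B \<le> 2 * card B'"
      "\<And>b. b \<in> B' \<Longrightarrow> card (nbs E A b) \<le> 2 * card (nbs E A' b)"
    by blast
  have "B' \<noteq> {}" using A'B'(4) Suc.prems(2,4) by auto
  moreover have "(8 * \<beta>) * card A' \<le> card B'"
  proof -
    have "\<beta> * (16 * card A') \<le> \<beta> * card A" using A'B'(3) by (rule mult_le_mono2)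
    then have "2 * ((8 * \<beta>) * card A') \<le> card B" using Suc.prems(7) by (simp only: mult_ac)
    then show ?thesis using A'B'(4) by linarith
  qed
  moreover have "2 ^ k * D \<le> card (nbs E A' b)" if "b \<in> B'" for b
    using Suc.prems(8)[of b] A'B'(5)[OF that] A'B'(2) that by auto
  moreover have "finite A'" "finite B'" "A' \<inter> B' = {}" "A' \<union> B' \<subseteq> X" "0 < 8 * \<beta>"
    using A'B'(1,2) Suc.prems(1,2,3,5,6) by (auto intro: finite_subset)
  ultimately have "\<exists>A''\<subseteq>A'. \<exists>B''\<subseteq>B'. B'' \<noteq> {} \<and> 8 ^ k * (8 * \<beta>) * card A'' \<le> card B'' \<and>
      (\<forall>b\<in>B''. D \<le> card (nbs E A'' b))"
    by (intro Suc.IH)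
  then obtain A'' B'' where *: "A'' \<subseteq> A'" "B'' \<subseteq> B'" "B'' \<noteq> {}" "8 ^ k * (8 * \<beta>) * card A'' \<le> card B''"
      "\<forall>b\<in>B''. D \<le> card (nbs E A'' b)"
    by blast
  have "8 ^ Suc k * \<beta> * card A'' \<le> card B''" using *(4) by (simp add: mult_ac)
  then show ?case using *(1,2,3,5) A'B'(1,2) by (meson order.trans)
qed

section \<open>Uniform subdivisions\<close>

text \<open>
  The only consequence of \<open>E\<close> containing the subdivision of \<open>Q\<close> with paths of length \<open>l\<close> that is
  needed; unlike subdivisions, it composes without any bookkeeping of paths.
\<close>

definition simulates :: "nat \<Rightarrow> 'v set set \<Rightarrow> 'v set set \<Rightarrow> 'v set \<Rightarrow> bool" where
  "simulates l E Q V \<longleftrightarrow>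
     (\<forall>Q'\<subseteq>Q. \<exists>E'\<subseteq>E. \<forall>x\<in>V. \<forall>y\<in>V. \<forall>k. reach Q' k x y \<longleftrightarrow> reach E' (l * k) x y)"

lemma simulates_subset: "Q \<subseteq> E \<Longrightarrow> simulates 1 E Q V"
  unfolding simulates_def by (metis mult_1 order.trans)

lemma simulates_mono:
  assumes "simulates l E Q V" "E \<subseteq> E'"
  shows "simulates l E' Q V"
  unfolding simulates_def
proof (intro allI impI)
  fix Q' assume "Q' \<subseteq> Q"
  from assms(1)[unfolded simulates_def, rule_format, OF this]
  obtain F where "F \<subseteq> E" "\<forall>x\<in>V. \<forall>y\<in>V. \<forall>k. reach Q' k x y \<longleftrightarrow> reach F (l * k) x y"
    by (elim exE conjE)
  with assms(2) show "\<exists>F\<subseteq>E'. \<forall>x\<in>V. \<forall>y\<in>V. \<forall>k. reach Q' k x y \<longleftrightarrow> reach F (l * k) x y"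
    by (intro exI[of _ F]) auto
qed

lemma simulates_trans:
  assumes EW: "simulates l E W A" and WQ: "simulates m W Q V" and VA: "V \<subseteq> A"
  shows "simulates (l * m) E Q V"
  unfolding simulates_def
proof (intro allI impI)
  fix Q' assume "Q' \<subseteq> Q"
  from WQ[unfolded simulates_def, rule_format, OF this]
  obtain W' where "W' \<subseteq> W" and W': "\<forall>x\<in>V. \<forall>y\<in>V. \<forall>k. reach Q' k x y \<longleftrightarrow> reach W' (m * k) x y"
    by (elim exE conjE)
  from EW[unfolded simulates_def, rule_format, OF this(1)]
  obtain E' where "E' \<subseteq> E" and E': "\<forall>x\<in>A. \<forall>y\<in>A. \<forall>k. reach W' k x y \<longleftrightarrow> reach E' (l * k) x y"
    by (elim exE conjE)
  have "reach Q' k x y \<longleftrightarrow> reach E' (l * m * k) x y" if "x \<in> V" "y \<in> V" for x y k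
  proof -
    have "x \<in> A" "y \<in> A" using that VA by auto
    then show ?thesis using W' E' that by (simp add: mult.assoc)
  qed
  then show "\<exists>E'\<subseteq>E. \<forall>x\<in>V. \<forall>y\<in>V. \<forall>k. reach Q' k x y \<longleftrightarrow> reach E' (l * m * k) x y"
    using \<open>E' \<subseteq> E\<close> by (intro exI[of _ E']) auto
qed

text \<open>Invariant of a walk in the subdivision: at an original vertex half of the steps are
  accounted for; at the middle of \<open>w\<close> some end of \<open>w\<close> was reached with one
  step fewer. Leaving the middle to either end then completes at most one edge of
  \<open>W\<close>.\<close>

lemma reach_subdivision:
  assumes W: "\<And>w. w \<in> W \<Longrightarrow> w \<subseteq> A \<and> card w = 2" and f: "inj_on f W" "f ` W \<inter> A = {}"
    and x: "x \<in> A"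
  defines "F \<equiv> (\<Union>w\<in>W. star (f w) w)"
  shows "reach F n x y \<Longrightarrow> (y \<in> A \<and> reach W (n div 2) x y) \<or>
     (\<exists>w\<in>W. y = f w \<and> 0 < n \<and> (\<exists>z\<in>w. reach W ((n - 1) div 2) x z))"
proof (induction n arbitrary: y)
  case 0
  then show ?case using x by auto
next
  case (Suc n)
  then obtain z where z: "reach F n x z" "z = y \<or> {z, y} \<in> F" by auto
  have edge: "(\<exists>w\<in>W. z = f w \<and> y \<in> w) \<or> (\<exists>w\<in>W. y = f w \<and> z \<in> w)" if "{z, y} \<in> F"
    using that by (auto simp: F_def star_def doubleton_eq_iff)
  from Suc.IH[OF z(1)] show ?case
  proof (elim disjE conjE bexE)
    assume zA: "z \<in> A" and r: "reach W (n div 2) x z"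
    show ?thesis
    proof (cases "z = y")
      case True
      have "reach W (Suc n div 2) x y"
        using reach_mono[OF r, of W "Suc n div 2"] True by (simp add: div_le_mono)
      then show ?thesis using zA True by blast
    next
      case False
      then obtain w where "w \<in> W" "y = f w" "z \<in> w"
        using z(2) edge zA f(2) by blast
      then show ?thesis using r by (intro disjI2 bexI[of _ w]) auto
    qed
  next
    fix w u
    assume w: "w \<in> W" "z = f w" "0 < n" and u: "u \<in> w" "reach W ((n - 1) div 2) x u"
    show ?thesis
    proof (cases "z = y")
      case True
      have "reach W ((Suc n - 1) div 2) x u"
        by (rule reach_mono[OF u(2)]) (auto simp: div_le_mono)
      then show ?thesis using w u True by blast
    next
      case False
      have zA: "z \<notin> A" using w f(2) by blast
      then have "y \<in> w"
        using False z(2) edge w f(1) W by (auto dest: inj_onD)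
      then have y: "y \<in> A" using W w by blast
      have "u = y \<or> {u, y} \<in> W"
      proof (cases "u = y")
        case False
        then have "{u, y} = w" using u(1) \<open>y \<in> w\<close> W[OF w(1)] by (auto simp: card_2_iff)
        then show ?thesis using w by simp
      qed simp
      then have r: "reach W (Suc ((n - 1) div 2)) x y" using u(2) by auto
      \<comment> \<open>False for \<open>n = 0\<close>, where the subtraction truncates; this is why
        the invariant carries \<open>0 < n\<close>.\<close>
      have "Suc ((n - 1) div 2) = Suc n div 2" using w(3) by (cases n) auto
      from r[unfolded this] y show ?thesis by blast
    qed
  qed
qed

text \<open>A subset of \<open>W\<close> is simulated by the two-edge paths through the middles
  \<open>f w\<close> of its members. Injectivity of \<open>f\<close> keeps different paths from
  sharing a middle.\<close>

lemma simulates_subdivision: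
  assumes W: "\<And>w. w \<in> W \<Longrightarrow> w \<subseteq> A \<and> card w = 2" and f: "inj_on f W" "f ` W \<inter> A = {}"
    and E: "\<And>w. w \<in> W \<Longrightarrow> star (f w) w \<subseteq> E"
  shows "simulates 2 E W A"
  unfolding simulates_def
proof (intro allI impI)
  fix W' assume W': "W' \<subseteq> W"
  define F where "F = (\<Union>w\<in>W'. star (f w) w)"
  have "F \<subseteq> E" using E W' by (auto simp: F_def)
  moreover have "reach W' k x y \<longleftrightarrow> reach F (2 * k) x y" if "x \<in> A" "y \<in> A" for x y k
  proof
    show "reach F (2 * k) x y" if "reach W' k x y" using that
    proof (induction k arbitrary: y)
      case (Suc k)
      then obtain z where z: "reach W' k x z" "z = y \<or> {z, y} \<in> W'" by auto
      have "reach F (Suc 0 + Suc 0) z y"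
      proof (cases "z = y")
        case False
        with z have zy: "{z, y} \<in> W'" by simp
        have "{z, f {z, y}} \<in> F" "{f {z, y}, y} \<in> F"
          using zy by (auto simp: F_def star_def insert_commute)
        then show ?thesis by (blast intro: reach_trans reach_edge)
      qed simp
      from reach_trans[OF Suc.IH[OF z(1)] this] show ?case by simp
    qed simp
  next
    assume r: "reach F (2 * k) x y"
    have W'2: "\<And>w. w \<in> W' \<Longrightarrow> w \<subseteq> A \<and> card w = 2" using W W' by blast
    have f': "inj_on f W'" "f ` W' \<inter> A = {}" using f W' by (auto intro: inj_on_subset)
    have "\<not> (\<exists>w\<in>W'. y = f w)" using f'(2) that by blast
    with reach_subdivision[OF W'2 f' that(1) r[unfolded F_def]]
    show "reach W' k x y" by auto
  qed
  ultimately show "\<exists>E'\<subseteq>E. \<forall>x\<in>A. \<forall>y\<in>A. \<forall>k. reach W' k x y \<longleftrightarrow> reach E' (2 * k) x y"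
    by (intro exI[of _ F]) auto
qed

lemma exists_subdivision:
  assumes fin: "finite A" "finite B" and B: "B \<noteq> {}" and AB: "d * card A \<le> card B"
  shows "\<exists>W f. (\<forall>w\<in>W. w \<subseteq> A \<and> card w = 2 \<and> star (f w) w \<subseteq> E) \<and> inj_on f W \<and> f ` W \<subseteq> B \<and>
     (d * card A \<le> card W \<or> (\<exists>b\<in>B. \<forall>x\<in>nbs E A b. \<forall>y\<in>nbs E A b. x \<noteq> y \<longrightarrow> {x, y} \<in> W))"
proof -
  define ok where "ok W f \<longleftrightarrow>
    (\<forall>w\<in>W. w \<subseteq> A \<and> card w = 2 \<and> star (f w) w \<subseteq> E) \<and> inj_on f W \<and> f ` W \<subseteq> B" for W f
  have "ok {} f" for f by (auto simp: ok_def)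
  moreover have "card W < Suc (card B)" if "ok W f" for W f
    using that card_inj_on_le[of f W B] fin by (auto simp: ok_def)
  ultimately obtain W f where ok: "ok W f" and max: "\<And>W' f'. ok W' f' \<Longrightarrow> card W' \<le> card W"
    using ex_has_greatest_nat[of "\<lambda>p. ok (fst p) (snd p)" "({}, undefined)" "\<lambda>p. card (fst p)" "Suc (card B)"]
    by (metis fst_conv snd_conv)
  have finW: "finite W"
    by (rule finite_subset[of _ "Pow A"]) (use ok fin in \<open>auto simp: ok_def\<close>)
  show ?thesis
  proof (cases "d * card A \<le> card W")
    case True
    with ok show ?thesis unfolding ok_def by (intro exI[of _ W] exI[of _ f]) simp
  next
    case False
    have "card (f ` W) = card W" using ok by (auto simp: ok_def intro: card_image)
    then have "f ` W \<noteq> B" using False AB by auto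
    then obtain b where b: "b \<in> B" "b \<notin> f ` W" using ok by (auto simp: ok_def)
    have "{x, y} \<in> W" if xy: "x \<in> nbs E A b" "y \<in> nbs E A b" "x \<noteq> y" for x y
    proof (rule ccontr)
      assume new: "{x, y} \<notin> W"
      let ?f = "f({x, y} := b)"
      have img: "?f ` W = f ` W" using new by auto
      have "inj_on ?f W" using ok new by (auto simp: ok_def inj_on_def)
      then have "inj_on ?f (insert {x, y} W)" using img b new by auto
      then have "ok (insert {x, y} W) ?f"
        using ok xy new b unfolding ok_def by (auto simp: nbs_def star_def insert_commute)
      from max[OF this] show False using new finW by simp
    qed
    then have "\<exists>b\<in>B. \<forall>x\<in>nbs E A b. \<forall>y\<in>nbs E A b. x \<noteq> y \<longrightarrow> {x, y} \<in> W"
      using b(1) by (intro bexI[of _ b] ballI impI)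
    with ok show ?thesis unfolding ok_def by (intro exI[of _ W] exI[of _ f]) simp
  qed
qed

section \<open>Large cuts and the descent to a dense graph of large girth\<close>

lemma card_nbs:
  "card (nbs E A v) = card {e \<in> E. \<exists>u\<in>A. e = {u, v}}"
proof -
  have "{e \<in> E. \<exists>u\<in>A. e = {u, v}} = (\<lambda>u. {u, v}) ` nbs E A v"
    by (auto simp: nbs_def)
  moreover have "inj_on (\<lambda>u. {u, v}) (nbs E A v)"
    by (auto simp: inj_on_def doubleton_eq_iff)
  ultimately show ?thesis by (simp add: card_image)
qed

text \<open>In a cut with the most edges, moving one vertex across gains nothing, so at least half
  of the edges at each vertex cross. This holds on both sides, so the larger side may be called
  \<open>B\<close>.\<close>

lemma max_cut:
  assumes finV: "finite V" and E: "\<And>e. e \<in> E \<Longrightarrow> e \<subseteq> V \<and> card e = 2"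
  obtains A B where "A \<union> B = V" "A \<inter> B = {}" "card A \<le> card B"
    "\<And>b. b \<in> B \<Longrightarrow> card {e \<in> E. b \<in> e} \<le> 2 * card (nbs E A b)"
proof -
  have finE: "finite E" using finite_subset[of E "Pow V"] E finV by auto
  define cut where "cut c = {e \<in> E. \<exists>x\<in>e. \<exists>y\<in>e. c x \<and> \<not> c y}" for c :: "'a \<Rightarrow> bool"
  have "card (cut c) < Suc (card E)" for c
    using card_mono[OF finE, of "cut c"] by (auto simp: cut_def less_Suc_eq_le)
  then obtain c where c: "\<And>c'. card (cut c') \<le> card (cut c)"
    using ex_has_greatest_nat[of "\<lambda>_. True" undefined "\<lambda>c. card (cut c)" "Suc (card E)"] by auto
  have half: "card {e \<in> E. v \<in> e} \<le> 2 * card (nbs E {u \<in> V. c u \<noteq> c v} v)" for v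
  proof -
    define K Ov N where "K = {e \<in> cut c. v \<notin> e}" and "Ov = {e \<in> cut c. v \<in> e}"
      and "N = {e \<in> E. v \<in> e} - cut c"
    have pair: "\<exists>u. u \<noteq> v \<and> e = {u, v} \<and> u \<in> V" if "e \<in> E" "v \<in> e" for e
      using E[OF that(1)] that(2) by (auto simp: card_2_iff)
    have fin: "finite K" "finite Ov" "finite N"
      using finE by (auto simp: K_def Ov_def N_def cut_def)
    \<comment> \<open>Moving \<open>v\<close> exchanges its crossing edges \<open>Ov\<close> for its
      other edges \<open>N\<close> and keeps the rest \<open>K\<close> of the cut.\<close>
    have "cut (c(v := \<not> c v)) = K \<union> N"
    proof (intro set_eqI)
      fix e
      show "e \<in> cut (c(v := \<not> c v)) \<longleftrightarrow> e \<in> K \<union> N"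
      proof (cases "e \<in> E \<and> v \<in> e")
        case True
        then obtain u where "u \<noteq> v" "e = {u, v}" using pair by blast
        then show ?thesis using True by (auto simp: cut_def K_def N_def)
      next
        case False
        then show ?thesis by (auto simp: cut_def K_def N_def)
      qed
    qed
    moreover have "cut c = K \<union> Ov" by (auto simp: K_def Ov_def)
    ultimately have "card (K \<union> N) \<le> card (K \<union> Ov)" using c[of "c(v := \<not> c v)"] by simp
    moreover have "card (K \<union> N) = card K + card N" "card (K \<union> Ov) = card K + card Ov"
      using fin by (auto intro!: card_Un_disjoint simp: K_def N_def Ov_def)
    ultimately have "card N \<le> card Ov" by simp
    moreover have "{e \<in> E. v \<in> e} = N \<union> Ov" by (auto simp: N_def Ov_def cut_def)
    then have "card {e \<in> E. v \<in> e} \<le> card N + card Ov" using card_Un_le by simp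
    moreover have "Ov = {e \<in> E. \<exists>u\<in>{u \<in> V. c u \<noteq> c v}. e = {u, v}}"
    proof (intro set_eqI)
      fix e
      show "e \<in> Ov \<longleftrightarrow> e \<in> {e \<in> E. \<exists>u\<in>{u \<in> V. c u \<noteq> c v}. e = {u, v}}"
      proof (cases "e \<in> E \<and> v \<in> e")
        case True
        then obtain u where "u \<noteq> v" "e = {u, v}" "u \<in> V" using pair by blast
        then show ?thesis using True by (auto simp: cut_def Ov_def doubleton_eq_iff)
      qed (auto simp: cut_def Ov_def)
    qed
    ultimately show ?thesis by (simp add: card_nbs)
  qed
  define A B where "A = {u \<in> V. c u}" and "B = {u \<in> V. \<not> c u}"
  have *: "A \<union> B = V" "A \<inter> B = {}" by (auto simp: A_def B_def)
  have "card {e \<in> E. v \<in> e} \<le> 2 * card (nbs E A v)" if "v \<in> B" for v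
    using half[of v] that by (simp add: A_def B_def)
  moreover have "card {e \<in> E. v \<in> e} \<le> 2 * card (nbs E B v)" if "v \<in> A" for v
    using half[of v] that by (simp add: A_def B_def)
  ultimately show ?thesis
    using that[of A B] that[of B A] * by (cases "card A \<le> card B") auto
qed

text \<open>Strong induction on \<open>card V\<close> with one fixed \<open>d\<close>: the graph
  \<open>W\<close> obtained on \<open>A'\<close> is again \<open>d\<close>-dense with fewer
  vertices, and passing back from \<open>W\<close> to \<open>E\<close> doubles the subdivision
  length.\<close>

theorem dense_imp_uniform_subdivision:
  fixes C t :: nat
  assumes C: "0 < C"
  shows "\<exists>d. \<forall>(V :: 'v set) E. finite V \<and> V \<noteq> {} \<and> (\<forall>e\<in>E. e \<subseteq> V \<and> card e = 2) \<and>
    d * card V \<le> card E \<longrightarrow> (\<exists>l U Q. simulates l E Q U \<and> U \<subseteq> V \<and> dense_girth C t U Q)"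
proof -
  \<comment> \<open>\<open>M\<close> is the degree that \<open>star_packing\<close> requires, and
    \<open>D = 2 * M\<close> lets a clique be split into two halves. After \<open>k\<close> rounds
    the ratio is \<open>8 ^ k = d\<close>. The value of \<open>k\<close> gives
    \<open>2 * (2 ^ k * D) = 2 ^ k * k \<le> d\<close>, so minimum degree \<open>d\<close> survives
    the cut and \<open>k\<close> halvings.\<close>
  define M D k d where "M = 2 * (C * (1 + 16 * C) ^ t)" and "D = 2 * M" and "k = 2 * D"
    and "d = (8 :: nat) ^ k"
  have M: "0 < M" using C by (simp add: M_def)
  have d: "2 * (2 ^ k * D) \<le> d"
  proof -
    have "k < 2 ^ k" by (rule less_exp)
    also have "(2 :: nat) ^ k \<le> 4 ^ k" by (rule power_mono) auto
    finally have "k \<le> 4 ^ k" by simp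
    then have "2 ^ k * k \<le> 2 ^ k * 4 ^ k" by simp
    then show ?thesis by (simp add: d_def k_def flip: power_mult_distrib)
  qed
  have "\<exists>l U Q. simulates l E Q U \<and> U \<subseteq> V \<and> dense_girth C t U Q"
    if "finite V" "V \<noteq> {}" "\<And>e. e \<in> E \<Longrightarrow> e \<subseteq> V \<and> card e = 2" "d * card V \<le> card E"
    for V :: "'v set" and E
    using that
  proof (induction "card V" arbitrary: V E rule: less_induct)
    case less
    note finV = less.prems(1) and E = less.prems(3) and dense = less.prems(4)
    have finE: "finite E" using finite_subset[of E "Pow V"] E finV by auto
    show ?case
    proof (cases "\<exists>v\<in>V. card {e \<in> E. v \<in> e} < d")
      \<comment> \<open>Deleting a vertex of degree below \<open>d\<close> preserves the density, so
        afterwards minimum degree \<open>d\<close> may be assumed.\<close>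
      case True
      then obtain v where v: "v \<in> V" "card {e \<in> E. v \<in> e} < d" by blast
      let ?V = "V - {v}" and ?E = "E - {e \<in> E. v \<in> e}"
      have cV: "card V = Suc (card ?V)" by (rule card_Suc_Diff1[OF finV v(1), symmetric])
      have "card E = card {e \<in> E. v \<in> e} + card ?E"
        using finE card_Diff_subset[of "{e \<in> E. v \<in> e}" E] card_mono[of E "{e \<in> E. v \<in> e}"] by simp
      moreover have "d * card V = d + d * card ?V" by (simp only: cV mult_Suc_right)
      ultimately have "d * card ?V \<le> card ?E" using dense v(2) by linarith
      moreover have "?V \<noteq> {}"
      proof
        assume "?V = {}"
        then have "V = {v}" using v by blast
        have "E = {}"
        proof (rule ccontr)
          assume "E \<noteq> {}"
          then obtain e where "e \<in> E" by blast
          then have "card e \<le> card {v}" "card e = 2" using E[of e] \<open>V = {v}\<close> card_mono[of "{v}" e] by auto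
          then show False by simp
        qed
        then show False using dense \<open>V = {v}\<close> by (simp add: d_def)
      qed
      moreover have E': "e \<subseteq> ?V \<and> card e = 2" if "e \<in> ?E" for e
        using E[of e] that by blast
      ultimately obtain l U Q where Q: "simulates l ?E Q U" "U \<subseteq> ?V" "dense_girth C t U Q"
        using less.hyps[OF card_Diff1_less[OF finV v(1)], of ?E] finV E' by blast
      have "simulates l E Q U" "U \<subseteq> V" using simulates_mono[OF Q(1), of E] Q(2) by auto
      with Q(3) show ?thesis by (intro exI[of _ l] exI[of _ U] exI[of _ Q] conjI)
    next
      case False
      then have deg: "d \<le> card {e \<in> E. v \<in> e}" if "v \<in> V" for v
        using that not_less by blast
      obtain A B where AB: "A \<union> B = V" "A \<inter> B = {}" "card A \<le> card B"
          and cut: "\<And>b. b \<in> B \<Longrightarrow> card {e \<in> E. b \<in> e} \<le> 2 * card (nbs E A b)"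
        using max_cut[OF finV E] by blast
      have finAB: "finite A" "finite B" using AB finV by auto
      have B: "B \<noteq> {}"
      proof
        assume "B = {}"
        then have "A = {}" using AB(3) finAB(1) by simp
        then show False using AB(1) \<open>B = {}\<close> less.prems(2) by simp
      qed
      show ?thesis
      proof (cases "\<exists>U Q. Q \<subseteq> E \<and> U \<subseteq> V \<and> dense_girth C t U Q")
        case True
        then obtain U Q where "Q \<subseteq> E" "U \<subseteq> V" "dense_girth C t U Q" by blast
        with simulates_subset[of Q E U] show ?thesis
          by (intro exI[of _ 1] exI[of _ U] exI[of _ Q] conjI)
      next
        case no: False
        have nb: "2 ^ k * D \<le> card (nbs E A b)" if "b \<in> B" for b
        proof -
          have "b \<in> V" using AB that by blast
          then show ?thesis using cut[OF that] deg[of b] d by linarith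
        qed
        have MD: "2 * (C * (1 + 16 * C) ^ t) \<le> D" by (simp add: D_def M_def)
        obtain A' B' where A'B': "A' \<subseteq> A" "B' \<subseteq> B" "B' \<noteq> {}" "8 ^ k * 1 * card A' \<le> card B'"
            and nb': "\<And>b. b \<in> B' \<Longrightarrow> D \<le> card (nbs E A' b)"
        proof -
          have "A \<union> B \<subseteq> V" "0 < (1 :: nat)" "1 * card A \<le> card B" using AB by auto
          from unbalanced_of_no_dense_girth[OF C MD no finAB AB(2) B this nb] show ?thesis using that by blast
        qed
        have fin': "finite A'" "finite B'" using A'B' finAB finite_subset by blast+
        obtain W f where W: "\<And>w. w \<in> W \<Longrightarrow> w \<subseteq> A' \<and> card w = 2"
            "\<And>w. w \<in> W \<Longrightarrow> star (f w) w \<subseteq> E" "inj_on f W" "f ` W \<subseteq> B'"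
            and large: "d * card A' \<le> card W \<or>
               (\<exists>b\<in>B'. \<forall>x\<in>nbs E A' b. \<forall>y\<in>nbs E A' b. x \<noteq> y \<longrightarrow> {x, y} \<in> W)"
        proof -
          have "d * card A' \<le> card B'" using A'B'(4) by (simp add: d_def)
          from exists_subdivision[OF fin' A'B'(3) this, of E] obtain W f
            where W: "\<forall>w\<in>W. w \<subseteq> A' \<and> card w = 2 \<and> star (f w) w \<subseteq> E" "inj_on f W" "f ` W \<subseteq> B'"
            and large: "d * card A' \<le> card W \<or>
              (\<exists>b\<in>B'. \<forall>x\<in>nbs E A' b. \<forall>y\<in>nbs E A' b. x \<noteq> y \<longrightarrow> {x, y} \<in> W)"
            by (elim exE conjE)
          show ?thesis
            by (rule that[of W f, OF _ _ W(2,3) large]) (use W(1) in simp_all)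
        qed
        have sim: "simulates 2 E W A'"
        proof (rule simulates_subdivision[OF W(1) W(3) _ W(2)])
          show "f ` W \<inter> A' = {}" using W(4) A'B'(1,2) AB(2) by blast
        qed
        have "\<exists>l U Q. simulates l W Q U \<and> U \<subseteq> A' \<and> dense_girth C t U Q"
          using large
        proof
          assume "d * card A' \<le> card W"
          moreover have "card A' < card V"
          proof (rule psubset_card_mono[OF finV])
            show "A' \<subset> V" using A'B'(1) B AB(1,2) by blast
          qed
          moreover have "A' \<noteq> {}"
          proof
            assume "A' = {}"
            moreover obtain b where "b \<in> B'" using A'B'(3) by blast
            ultimately show False using nb'[of b] M by (simp add: nbs_def D_def)
          qed
          ultimately show ?thesis using less.hyps[of A' W] W(1) fin' by blast
        next
          assume "\<exists>b\<in>B'. \<forall>x\<in>nbs E A' b. \<forall>y\<in>nbs E A' b. x \<noteq> y \<longrightarrow> {x, y} \<in> W"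
          then obtain b where b: "b \<in> B'"
              and clique: "\<And>x y. x \<in> nbs E A' b \<Longrightarrow> y \<in> nbs E A' b \<Longrightarrow> x \<noteq> y \<Longrightarrow> {x, y} \<in> W"
            by blast
          have XA: "nbs E A' b \<subseteq> A'" by (auto simp: nbs_def)
          \<comment> \<open>Two disjoint sets of \<open>M\<close> clique vertices give a complete
            bipartite graph inside \<open>W\<close>, in which star packing cannot get stuck.\<close>
          have "M \<le> card (nbs E A' b)" using nb'[OF b] by (simp add: D_def)
          then obtain P where P: "P \<subseteq> nbs E A' b" "card P = M" "finite P"
            by (meson obtain_subset_with_card_n)
          then have "M \<le> card (nbs E A' b - P)"
            using nb'[OF b] by (simp add: D_def card_Diff_subset)
          then obtain R where R: "R \<subseteq> nbs E A' b - P" "card R = M" "finite R"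
            by (meson obtain_subset_with_card_n)
          have nbR: "nbs W P r = P" if "r \<in> R" for r
            using clique P R that by (auto simp: nbs_def)
          have "R \<noteq> {}" using R M by auto
          show ?thesis
          proof (cases "\<exists>U Q. Q \<subseteq> W \<and> U \<subseteq> P \<union> R \<and> dense_girth C t U Q")
            case True
            then obtain U Q where "Q \<subseteq> W" "U \<subseteq> P \<union> R" "dense_girth C t U Q" by blast
            moreover from this have "U \<subseteq> A'" using P(1) R(1) XA by blast
            ultimately show ?thesis using simulates_subset[of Q W U]
              by (intro exI[of _ 1] exI[of _ U] exI[of _ Q] conjI)
          next
            case none: False
            have PR: "P \<inter> R = {}" "card P \<le> card R" using P(2) R(1,2) by auto
            have nbP: "2 * (C * (1 + 16 * C) ^ t) \<le> card (nbs W P r)" if "r \<in> R" for r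
              using nbR[OF that] P(2) by (simp add: M_def)
            from star_packing[OF P(3) R(3) PR(1) \<open>R \<noteq> {}\<close> PR(2) C nbP none]
            obtain P' R' where P'R': "P' \<subseteq> P" "R' \<subseteq> R" "16 * card P' \<le> card P" "card R \<le> 2 * card R'"
              "\<And>r. r \<in> R' \<Longrightarrow> card (nbs W P r) \<le> 2 * card (nbs W P' r)" by blast
            then have "R' \<noteq> {}" using R M by auto
            then obtain r where r: "r \<in> R'" by blast
            \<comment> \<open>At least half of the \<open>M\<close> neighbours of \<open>r\<close>
              would lie in \<open>P'\<close>, which has at most \<open>M / 16\<close>
              elements.\<close>
            have "card (nbs W P' r) \<le> card P'"
              using P'R'(1) P(3) by (intro card_mono) (auto simp: nbs_def intro: finite_subset)
            moreover have "card (nbs W P r) = M" using nbR[of r] r P'R'(2) P(2) by auto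
            ultimately have False using P'R'(3) P'R'(5)[OF r] P(2) M by simp
            then show ?thesis ..
          qed
        qed
        then obtain l U Q where Q: "simulates l W Q U" "U \<subseteq> A'" "dense_girth C t U Q" by blast
        have "U \<subseteq> V" using Q(2) A'B'(1) AB(1) by blast
        with simulates_trans[OF sim Q(1,2)] Q(3) show ?thesis
          by (intro exI[of _ "2 * l"] exI[of _ U] exI[of _ Q] conjI)
      qed
    qed
  qed
  note main = this
  show ?thesis
  proof (rule exI[of _ d], intro allI impI, elim conjE)
    fix V :: "'v set" and E
    assume *: "finite V" "V \<noteq> {}" "\<forall>e\<in>E. e \<subseteq> V \<and> card e = 2" "d * card V \<le> card E"
    show "\<exists>l U Q. simulates l E Q U \<and> U \<subseteq> V \<and> dense_girth C t U Q"
      by (rule main[OF *(1,2) bspec[OF *(3)] *(4)])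
  qed
qed

section \<open>Counting sketches\<close>

text \<open>Every element independently contributes 1 for agreement with \<open>A\<close> or
  \<open>1 / 2\<close> for disagreement, so the sum is the expansion of a product with all factors
  \<open>1 + 1 / 2\<close>.\<close>

lemma sum_Pow_half_power_symdiff:
  assumes "finite X" "A \<subseteq> X"
  shows "(\<Sum>Q\<in>Pow X. (1 / 2 :: real) ^ card ((A - Q) \<union> (Q - A))) = (3 / 2) ^ card X"
proof -
  define f g :: "'a \<Rightarrow> real" where "f i = (if i \<in> A then 1 else 1 / 2)"
    and "g i = (if i \<in> A then 1 / 2 else 1)" for i
  have "(3 / 2) ^ card X = (\<Prod>i\<in>X. f i + g i)"
  proof -
    have "f i + g i = 3 / 2" for i by (simp add: f_def g_def)
    then show ?thesis by (simp only: prod_constant)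
  qed
  also have "\<dots> = (\<Sum>Q\<in>Pow X. prod f Q * prod g (X - Q))"
    by (rule prod_add[OF assms(1)])
  also have "\<dots> = (\<Sum>Q\<in>Pow X. (1 / 2) ^ card ((A - Q) \<union> (Q - A)))"
  proof (rule sum.cong[OF refl])
    fix Q assume "Q \<in> Pow X"
    then have fin: "finite Q" "finite (X - Q)" "Q \<subseteq> X" using assms finite_subset by auto
    have "prod f Q = (1 / 2) ^ card (Q - A)"
      using fin by (simp add: f_def prod.If_cases Diff_eq)
    moreover have "(X - Q) \<inter> A = A - Q" using assms by auto
    then have "prod g (X - Q) = (1 / 2) ^ card (A - Q)"
      using fin by (simp add: g_def prod.If_cases)
    moreover have "card ((A - Q) \<union> (Q - A)) = card (A - Q) + card (Q - A)"
      using assms fin by (intro card_Un_disjoint) (auto intro: finite_subset)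
    ultimately show "prod f Q * prod g (X - Q) = (1 / 2) ^ card ((A - Q) \<union> (Q - A))"
      by (simp add: power_add)
  qed
  finally show ?thesis by simp
qed

text \<open>Covering bound with exponential weights in place of sizes of Hamming balls: with
  \<open>m = card X\<close>, each \<open>Q\<close> receives total weight at least
  \<open>(1 / 2) ^ (m div 3)\<close>, while each codeword hands out exactly
  \<open>(3 / 2) ^ m\<close>.\<close>

lemma card_approximate_code_ge:
  assumes fin: "finite X" "finite L" and dec: "\<And>g. g \<in> L \<Longrightarrow> dec g \<subseteq> X"
    and approx: "\<And>Q. Q \<subseteq> X \<Longrightarrow> \<exists>g\<in>L. 3 * card ((dec g - Q) \<union> (Q - dec g)) \<le> card X"
  shows "4 ^ card X \<le> real (card L) ^ 3 * (27 / 8) ^ card X"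
proof -
  let ?m = "card X"
  have "2 ^ ?m * (1 / 2 :: real) ^ (?m div 3) = (\<Sum>Q\<in>Pow X. (1 / 2) ^ (?m div 3))"
    using fin by (simp add: card_Pow)
  also have "\<dots> \<le> (\<Sum>Q\<in>Pow X. \<Sum>g\<in>L. (1 / 2) ^ card ((dec g - Q) \<union> (Q - dec g)))"
  proof (rule sum_mono)
    fix Q assume "Q \<in> Pow X"
    then obtain g where g: "g \<in> L" "3 * card ((dec g - Q) \<union> (Q - dec g)) \<le> card X"
      using approx by blast
    then have "(1 / 2 :: real) ^ (?m div 3) \<le> (1 / 2) ^ card ((dec g - Q) \<union> (Q - dec g))"
      by (intro power_decreasing) auto
    also have "\<dots> \<le> (\<Sum>g\<in>L. (1 / 2) ^ card ((dec g - Q) \<union> (Q - dec g)))"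
      using fin g(1) by (intro member_le_sum) auto
    finally show "(1 / 2 :: real) ^ (?m div 3) \<le> (\<Sum>g\<in>L. (1 / 2) ^ card ((dec g - Q) \<union> (Q - dec g)))" .
  qed
  also have "\<dots> = (\<Sum>g\<in>L. \<Sum>Q\<in>Pow X. (1 / 2) ^ card ((dec g - Q) \<union> (Q - dec g)))"
    by (rule sum.swap)
  also have "\<dots> = (\<Sum>g\<in>L. (3 / 2) ^ ?m)"
    using dec by (intro sum.cong refl sum_Pow_half_power_symdiff fin) auto
  also have "\<dots> = real (card L) * (3 / 2) ^ ?m" by simp
  \<comment> \<open>Cubing clears the third in the exponent: \<open>3 * (m div 3) \<le> m\<close>,
    and \<open>8 / 2 = 4\<close>.\<close>
  finally have *: "(2 ^ ?m * (1 / 2 :: real) ^ (?m div 3)) ^ 3 \<le> (real (card L) * (3 / 2) ^ ?m) ^ 3"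
    by (intro power_mono) auto
  have **: "8 ^ ?m * (1 / 2 :: real) ^ (3 * (?m div 3)) \<le> real (card L) ^ 3 * (27 / 8) ^ ?m"
  proof -
    have sw: "(x ^ n) ^ 3 = (x ^ 3) ^ n" for x :: real and n
      by (simp add: mult.commute flip: power_mult)
    have "(2 :: real) ^ 3 = 8" "(3 / 2 :: real) ^ 3 = 27 / 8" by (simp_all add: power_divide)
    then show ?thesis
      using * unfolding power_mult_distrib sw power_mult by (simp only:)
  qed
  have "(4 :: real) ^ ?m = 8 ^ ?m * (1 / 2) ^ ?m" by (simp flip: power_mult_distrib)
  also have "\<dots> \<le> 8 ^ ?m * (1 / 2) ^ (3 * (?m div 3))"
    by (intro mult_left_mono power_decreasing) auto
  also note **
  finally show ?thesis .
qed

text \<open>The expected number of failing events is at most a third of their number, so some sample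
  in the support does no worse.\<close>

lemma exists_mostly_correct_sample:
  fixes p :: "'s pmf"
  assumes fin: "finite X" and prob: "\<And>e. e \<in> X \<Longrightarrow> measure_pmf.prob p {\<omega>. ev e \<omega>} \<ge> 2 / 3"
  shows "\<exists>\<omega>\<in>set_pmf p. 3 * card {e \<in> X. \<not> ev e \<omega>} \<le> card X"
proof (rule ccontr)
  assume "\<not> ?thesis"
  then have many: "card X < 3 * card {e \<in> X. \<not> ev e \<omega>}" if "\<omega> \<in> set_pmf p" for \<omega>
    using that not_le by blast
  let ?h = "\<lambda>\<omega>. \<Sum>e\<in>X. indicator {\<omega>. \<not> ev e \<omega>} \<omega> :: real"
  have h: "?h \<omega> = real (card {e \<in> X. \<not> ev e \<omega>})" for \<omega>
    using fin by (simp add: indicator_def sum.If_cases Int_def)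
  have int: "integrable (measure_pmf p) (\<lambda>\<omega>. indicator {\<omega>. \<not> ev e \<omega>} \<omega> :: real)" for e
    by (rule measure_pmf.integrable_const_bound[of _ 1]) (auto simp: indicator_def)
  \<comment> \<open>Counts are integers, so exceeding a third of \<open>card X\<close> means
    reaching \<open>(card X + 1) / 3\<close>; this gap contradicts the expectation.\<close>
  have "(real (card X) + 1) / 3 \<le> measure_pmf.expectation p ?h"
  proof (rule measure_pmf.integral_ge_const)
    show "integrable (measure_pmf p) ?h" using int by (rule Bochner_Integration.integrable_sum)
    have "(real (card X) + 1) / 3 \<le> ?h \<omega>" if "\<omega> \<in> set_pmf p" for \<omega>
    proof -
      have "real (Suc (card X)) \<le> real (3 * card {e \<in> X. \<not> ev e \<omega>})"
        using many[OF that] by (simp only: of_nat_le_iff Suc_le_eq)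
      then show ?thesis unfolding h by simp
    qed
    then show "AE \<omega> in measure_pmf p. (real (card X) + 1) / 3 \<le> ?h \<omega>"
      by (simp add: AE_measure_pmf_iff)
  qed
  also have "\<dots> = (\<Sum>e\<in>X. measure_pmf.prob p {\<omega>. \<not> ev e \<omega>})"
    using int by (subst Bochner_Integration.integral_sum) auto
  also have "\<dots> \<le> (\<Sum>e\<in>X. 1 / 3)"
  proof (rule sum_mono)
    fix e assume "e \<in> X"
    have "measure_pmf.prob p {\<omega>. \<not> ev e \<omega>} = 1 - measure_pmf.prob p {\<omega>. ev e \<omega>}"
      using measure_pmf.prob_compl[of "{\<omega>. ev e \<omega>}" p] by (simp add: Compl_eq_Diff_UNIV[symmetric] Collect_neg_eq)
    then show "measure_pmf.prob p {\<omega>. \<not> ev e \<omega>} \<le> 1 / 3" using prob[OF \<open>e \<in> X\<close>] by simp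
  qed
  also have "\<dots> = real (card X) / 3" by simp
  finally show False by simp
qed

text \<open>The constant comes from \<open>(32 / 27) ^ 13 > 8\<close>.\<close>

lemma no_edge_sketch:
  fixes c :: "'v \<Rightarrow> 'b" and D :: "bool list \<Rightarrow> bool list \<Rightarrow> bool"
  assumes Q: "dense_girth (39 * s + 3) t V Q"
    and sketch: "\<And>Q'. Q' \<subseteq> Q \<Longrightarrow> \<exists>p :: ('b \<Rightarrow> bool list) pmf.
      (\<forall>sk\<in>set_pmf p. \<forall>x\<in>V. length (sk (c x)) = s) \<and>
      (\<forall>x y. {x, y} \<in> Q' \<longrightarrow> measure_pmf.prob p {sk. D (sk (c x)) (sk (c y))} \<ge> 2 / 3) \<and>
      (\<forall>x y. {x, y} \<in> Q - Q' \<longrightarrow> measure_pmf.prob p {sk. \<not> D (sk (c x)) (sk (c y))} \<ge> 2 / 3)"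
  shows False
proof -
  from Q have V: "V \<noteq> {}" "finite V" and QV: "\<And>e. e \<in> Q \<Longrightarrow> e \<subseteq> V \<and> card e = 2"
    and dense: "(39 * s + 3) * card V \<le> 3 * card Q"
    by (auto simp: dense_girth_def)
  have finQ: "finite Q" using finite_subset[of Q "Pow V"] QV V(2) by auto
  \<comment> \<open>\<open>D\<close> may depend on the order of its arguments, so each edge is
    decoded with its ends in one fixed order.\<close>
  have "\<forall>e\<in>Q. \<exists>x y. e = {x, y}" using QV by (metis card_2_iff)
  then obtain u w where uw: "\<And>e. e \<in> Q \<Longrightarrow> e = {u e, w e}" by metis
  define L where "L = V \<rightarrow>\<^sub>E {l :: bool list. length l = s}"
  define dec where "dec g = {e \<in> Q. D (g (u e)) (g (w e))}" for g
  have "card {l :: bool list. length l = s} = 2 ^ s" and finl: "finite {l :: bool list. length l = s}"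
    using card_lists_length_eq[of "UNIV :: bool set" s] finite_lists_length_eq[of "UNIV :: bool set" s] by auto
  then have L: "finite L" "card L = (2 ^ s) ^ card V"
    using V(2) by (auto simp: L_def card_PiE intro: finite_PiE)
  have code: "4 ^ card Q \<le> real (card L) ^ 3 * (27 / 8) ^ card Q"
  proof (rule card_approximate_code_ge[OF finQ L(1)])
    show "dec g \<subseteq> Q" for g by (auto simp: dec_def)
    fix Q' assume Q': "Q' \<subseteq> Q"
    from sketch[OF Q'] obtain p :: "('b \<Rightarrow> bool list) pmf"
      where p: "\<forall>sk\<in>set_pmf p. \<forall>x\<in>V. length (sk (c x)) = s"
        "\<forall>x y. {x, y} \<in> Q' \<longrightarrow> measure_pmf.prob p {sk. D (sk (c x)) (sk (c y))} \<ge> 2 / 3"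
        "\<forall>x y. {x, y} \<in> Q - Q' \<longrightarrow> measure_pmf.prob p {sk. \<not> D (sk (c x)) (sk (c y))} \<ge> 2 / 3"
      by (elim exE conjE)
    have correct: "2 / 3 \<le> measure_pmf.prob p {sk. D (sk (c (u e))) (sk (c (w e))) \<longleftrightarrow> e \<in> Q'}" if "e \<in> Q" for e
    proof (cases "e \<in> Q'")
      case True
      then have "{u e, w e} \<in> Q'" using uw[OF that] by simp
      then show ?thesis using p(2) True by simp
    next
      case False
      then have "{u e, w e} \<in> Q - Q'" using uw[OF that] that by simp
      then show ?thesis using p(3) False by simp
    qed
    have "\<exists>sk\<in>set_pmf p. 3 * card {e \<in> Q. \<not> (D (sk (c (u e))) (sk (c (w e))) \<longleftrightarrow> e \<in> Q')} \<le> card Q"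
      by (rule exists_mostly_correct_sample[OF finQ]) (rule correct)
    then obtain sk where sk: "sk \<in> set_pmf p"
      "3 * card {e \<in> Q. \<not> (D (sk (c (u e))) (sk (c (w e))) \<longleftrightarrow> e \<in> Q')} \<le> card Q" by blast
    define g where "g = restrict (\<lambda>x. sk (c x)) V"
    have "g \<in> L" using p(1) sk(1) by (simp add: g_def L_def)
    have guw: "g (u e) = sk (c (u e))" "g (w e) = sk (c (w e))" if "e \<in> Q" for e
      using uw[OF that] QV[OF that] by (auto simp: g_def)
    have "(dec g - Q') \<union> (Q' - dec g) = {e \<in> Q. \<not> (D (sk (c (u e))) (sk (c (w e))) \<longleftrightarrow> e \<in> Q')}"
      using Q' guw by (auto simp: dec_def)
    then show "\<exists>g\<in>L. 3 * card ((dec g - Q') \<union> (Q' - dec g)) \<le> card Q"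
      using sk(2) \<open>g \<in> L\<close> by (intro bexI[of _ g]) simp_all
  qed
  have "(32 / 27 :: real) ^ card Q * (27 / 8) ^ card Q = 4 ^ card Q"
    by (simp flip: power_mult_distrib)
  also note code
  finally have "(32 / 27 :: real) ^ card Q \<le> real (card L) ^ 3"
    by (rule mult_right_le_imp_le) simp_all
  also have "real (card L) ^ 3 = 8 ^ (s * card V)"
    by (simp add: L(2) power_mult[symmetric] mult.commute[of _ "3 :: nat"] power_mult[of "2 :: real" 3] mult.assoc)
  finally have up: "(32 / 27 :: real) ^ card Q \<le> 8 ^ (s * card V)" .
  \<comment> \<open>The summand 3 in \<open>39 * s + 3\<close>, with \<open>V\<close> nonempty,
    yields the extra factor \<open>32 / 27\<close> that makes the final inequality strict.\<close>
  have "Suc (13 * (s * card V)) \<le> card Q"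
    using dense V by (cases "card V") (auto simp: algebra_simps)
  then have "(32 / 27 :: real) ^ Suc (13 * (s * card V)) \<le> (32 / 27) ^ card Q"
    by (intro power_increasing) auto
  moreover have "8 ^ (s * card V) < (32 / 27 :: real) ^ Suc (13 * (s * card V))"
  proof -
    have "(8 :: real) ^ (s * card V) \<le> ((32 / 27) ^ 13) ^ (s * card V)"
      by (intro power_mono) (auto simp: power_divide)
    also have "\<dots> < (32 / 27) * ((32 / 27) ^ 13) ^ (s * card V)" by simp
    finally show ?thesis by (simp add: power_mult)
  qed
  ultimately show False using up by linarith
qed

section \<open>Distances and depth-bounded minors\<close>

definition edges :: "'v pair_pre_digraph \<Rightarrow> 'v set set" where
  "edges G = {{x, y} | x y. (x, y) \<in> parcs G}"

lemma doubleton_mem_edges: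
  assumes "pair_graph G"
  shows "{x, y} \<in> edges G \<longleftrightarrow> (x, y) \<in> parcs G"
proof -
  interpret pair_graph G by fact
  show ?thesis by (auto simp: edges_def doubleton_eq_iff dest: arcs_symmetric)
qed

lemma graph_dist_le_of_reach:
  assumes "pair_graph G" "reach (edges G) k x y" "x \<in> pverts G"
  shows "graph_dist G x y \<le> ereal (real k)"
proof -
  interpret pair_graph G by fact
  have "\<exists>p. awalk x p y \<and> length p \<le> k"
    using assms(2)
  proof (induction k arbitrary: y)
    case 0
    then show ?case using assms(3) by (intro exI[of _ "[]"]) (simp add: awalk_Nil_iff)
  next
    case (Suc k)
    then obtain z where z: "reach (edges G) k x z" "z = y \<or> {z, y} \<in> edges G" by auto
    obtain p where p: "awalk x p z" "length p \<le> k" using Suc.IH[OF z(1)] by blast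
    show ?case
    proof (cases "z = y")
      case True
      then show ?thesis using p by (intro exI[of _ p]) simp
    next
      case False
      then have "(z, y) \<in> parcs G" using z(2) doubleton_mem_edges[OF assms(1)] by blast
      then have "awalk z [(z, y)] y" by (simp add: awalk_simps in_arcsD1 in_arcsD2)
      with p(1) have "awalk x (p @ [(z, y)]) y" by (rule awalk_appendI)
      then show ?thesis using p(2) by (intro exI[of _ "p @ [(z, y)]"]) simp
    qed
  qed
  then obtain p where p: "awalk x p y" "length p \<le> k" by blast
  have "awalk_cost (\<lambda>_. 1) p = real (length p)" by (induction p) auto
  then show ?thesis
    using min_cost_le_walk_cost[OF p(1), of "\<lambda>_. 1"] p(2)
    unfolding graph_dist_def by (simp add: order.trans)
qed

lemma reach_of_graph_dist_le:
  assumes "pair_graph G" "graph_dist G x y \<le> ereal c"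
  shows "reach (edges G) (nat \<lfloor>c\<rfloor>) x y"
proof -
  interpret pair_graph G by fact
  have cost: "awalk_cost (\<lambda>_. 1) p = real (length p)" for p by (induction p) auto
  \<comment> \<open>A strict bound on an infimum is met by an actual walk; its length is an integer,
    hence at most the floor.\<close>
  have "graph_dist G x y < ereal (of_int \<lfloor>c\<rfloor> + 1)"
    using assms(2) by (rule order.strict_trans1) simp
  then obtain p where p: "awalk x p y" "ereal (awalk_cost (\<lambda>_. 1) p) < ereal (of_int \<lfloor>c\<rfloor> + 1)"
    unfolding graph_dist_def \<mu>_def by (auto simp: INF_less_iff)
  have "reach (edges G) (length p) x y"
    using p(1)
  proof (induction p arbitrary: x)
    case Nil
    then show ?case by (simp add: awalk_Nil_iff)
  next
    case (Cons e p)
    then have e: "e \<in> parcs G" "x = fst e" "awalk (snd e) p y" by (auto simp: awalk_Cons_iff)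
    then have "{x, snd e} \<in> edges G" using doubleton_mem_edges[OF assms(1)] by simp
    from reach_trans[OF reach_edge[OF this] Cons.IH[OF e(3)]] show ?case by simp
  qed
  moreover have "length p \<le> nat \<lfloor>c\<rfloor>" using p(2) by (simp add: cost)
  ultimately show ?thesis by (rule reach_mono[OF _ order_refl])
qed

section \<open>Realizing the subgraphs of a depth-bounded minor in the host graph\<close>

lemma simple_subgraph_imp_pair_graph: "simple_subgraph H G \<Longrightarrow> pair_graph H"
  by (simp add: simple_subgraph_def)

lemma simple_subgraph_trans: "simple_subgraph K H \<Longrightarrow> simple_subgraph H G \<Longrightarrow> simple_subgraph K G"
  unfolding simple_subgraph_def using subgraph_trans by blast

lemma simple_subgraph_subset:
  assumes "simple_subgraph H G"
  shows "pverts H \<subseteq> pverts G" "parcs H \<subseteq> parcs G"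
  using assms by (auto simp: simple_subgraph_def subgraph_def)

lemma exists_center:
  assumes B: "pair_graph B" and r: "graph_radius B \<le> ereal (real r)"
  shows "\<exists>c\<in>pverts B. \<forall>v\<in>pverts B. reach (edges B) r c v"
proof -
  \<comment> \<open>The \<open>1 / 2\<close> makes the bound strict, so that some vertex meets it;
    rounding down removes it again.\<close>
  have "graph_radius B < ereal (real r + 1 / 2)" using r by (rule order.strict_trans1) simp
  then obtain c where c: "c \<in> pverts B" "(SUP v\<in>pverts B. graph_dist B c v) < ereal (real r + 1 / 2)"
    unfolding graph_radius_def by (auto simp: INF_less_iff)
  have "reach (edges B) r c v" if "v \<in> pverts B" for v
  proof -
    have "graph_dist B c v \<le> (SUP v\<in>pverts B. graph_dist B c v)" using that by (rule SUP_upper)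
    also have "\<dots> \<le> ereal (real r + 1 / 2)" using c(2) by (rule less_imp_le)
    finally have "reach (edges B) (nat \<lfloor>real r + 1 / 2\<rfloor>) c v" by (rule reach_of_graph_dist_le[OF B])
    moreover have "\<lfloor>real r + 1 / 2\<rfloor> = int r" by linarith
    ultimately show ?thesis by simp
  qed
  then show ?thesis using c(1) by (intro bexI[of _ c] ballI)
qed

lemma pverts_contract:
  "pverts (contract G P) = pverts ` P \<union> {{v} | v. v \<in> pverts G \<and> (\<forall>B\<in>P. v \<notin> pverts B)}"
  by (simp add: contract_def Let_def)

lemma parcs_contract:
  "parcs (contract G P) = {(X, Y). X \<in> pverts (contract G P) \<and> Y \<in> pverts (contract G P) \<and> X \<noteq> Y \<and>
     (\<exists>x\<in>X. \<exists>y\<in>Y. (x, y) \<in> parcs G)}"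
  by (simp add: contract_def Let_def)

lemma edges_contract:
  assumes "pair_graph G" "{X, Y} \<in> edges (contract G P)"
  shows "\<exists>x\<in>X. \<exists>y\<in>Y. {x, y} \<in> edges G"
proof -
  from assms(2) consider "(X, Y) \<in> parcs (contract G P)" | "(Y, X) \<in> parcs (contract G P)"
    unfolding edges_def by (auto simp: doubleton_eq_iff)
  then obtain x y where "x \<in> X" "y \<in> Y" "(x, y) \<in> parcs G \<or> (y, x) \<in> parcs G"
    unfolding parcs_contract by cases auto
  then show ?thesis
    using doubleton_mem_edges[OF assms(1)] by (metis insert_commute)
qed

text \<open>\<open>c\<close> picks a centre of each branch set. An edge of \<open>H'\<close> lifts
  to a walk of length \<open>r + 1 + r\<close> between centres, and mapping vertices to their branch
  sets never lengthens a walk. The centres are chosen before \<open>H'\<close>, as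
  \<open>no_edge_sketch\<close> works with a single \<open>c\<close>.\<close>

lemma depth_minor_realization:
  fixes G :: "'v pair_pre_digraph"
  assumes "depth_minor r H G"
  shows "finite (pverts H)"
    and "\<exists>c. \<forall>H'\<subseteq>edges H. \<exists>G'. simple_subgraph G' G \<and> (\<forall>X\<in>pverts H. c X \<in> pverts G') \<and>
       (\<forall>X\<in>pverts H. \<forall>Y\<in>pverts H. \<forall>k.
          (reach H' k X Y \<longrightarrow> reach (edges G') (k * (2 * r + 1)) (c X) (c Y)) \<and>
          (reach (edges G') k (c X) (c Y) \<longrightarrow> reach H' k X Y))"
proof -
  from assms obtain K P where K: "simple_subgraph K G"
    and P: "\<And>B. B \<in> P \<Longrightarrow> simple_subgraph B K" "\<And>B. B \<in> P \<Longrightarrow> graph_radius B \<le> ereal (real r)"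
    and disj: "pairwise (\<lambda>B C. disjnt (pverts B) (pverts C)) P" and H: "H = contract K P"
    unfolding depth_minor_def by metis
  interpret K: pair_graph K using K by (rule simple_subgraph_imp_pair_graph)
  let ?W = "pverts H"
  have WK: "X \<subseteq> pverts K" if "X \<in> ?W" for X
    using that simple_subgraph_subset(1)[OF P(1)] unfolding H pverts_contract by auto
  have finW: "finite ?W"
    by (rule finite_subset[of _ "Pow (pverts K)"]) (use WK K.pair_finite_verts in auto)
  have cover: "\<exists>X\<in>?W. v \<in> X" if "v \<in> pverts K" for v
    using that unfolding H pverts_contract by (cases "\<exists>B\<in>P. v \<in> pverts B") auto
  have unique: "X = Y" if "X \<in> ?W" "Y \<in> ?W" "v \<in> X" "v \<in> Y" for X Y v
  proof -
    have "B = C" if "B \<in> P" "C \<in> P" "v \<in> pverts B" "v \<in> pverts C" for B C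
      using pairwiseD[OF disj that(1,2)] that(3,4) by (auto simp: disjnt_def)
    then show ?thesis using that unfolding H pverts_contract by auto
  qed
  \<comment> \<open>Edges inside branch sets: they occur in every realization, so the centres can be
    chosen once and for all.\<close>
  define I where "I = {{x, y} | x y. (x, y) \<in> parcs K \<and> (\<exists>X\<in>?W. x \<in> X \<and> y \<in> X)}"
  have "\<exists>c\<in>X. \<forall>v\<in>X. reach I r c v" if X: "X \<in> ?W" for X
  proof -
    from X consider B where "B \<in> P" "X = pverts B" | v where "X = {v}"
      unfolding H pverts_contract by auto
    then show ?thesis
    proof cases
      case 1
      then interpret B: pair_graph B using P(1) simple_subgraph_imp_pair_graph by blast
      obtain c where c: "c \<in> pverts B" "\<And>v. v \<in> pverts B \<Longrightarrow> reach (edges B) r c v"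
        using exists_center[OF B.pair_graph P(2)[OF 1(1)]] by blast
      have "edges B \<subseteq> I"
      proof
        fix e assume "e \<in> edges B"
        then obtain x y where e: "e = {x, y}" "(x, y) \<in> parcs B" by (auto simp: edges_def)
        then have "(x, y) \<in> parcs K" "x \<in> X" "y \<in> X"
          using simple_subgraph_subset(2)[OF P(1)[OF 1(1)]] 1(2) B.in_arcsD1 B.in_arcsD2 by auto
        then show "e \<in> I" using X e(1) by (auto simp: I_def)
      qed
      then have "reach I r c v" if "v \<in> X" for v
        using reach_mono[OF c(2)] 1(2) that by simp
      then show ?thesis using c(1) 1(2) by (intro bexI[of _ c]) simp_all
    qed simp
  qed
  then obtain c where c: "\<And>X. X \<in> ?W \<Longrightarrow> c X \<in> X" "\<And>X v. X \<in> ?W \<Longrightarrow> v \<in> X \<Longrightarrow> reach I r (c X) v"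
    by metis
  have "\<exists>G'. simple_subgraph G' G \<and> (\<forall>X\<in>pverts H. c X \<in> pverts G') \<and>
       (\<forall>X\<in>pverts H. \<forall>Y\<in>pverts H. \<forall>k.
          (reach H' k X Y \<longrightarrow> reach (edges G') (k * (2 * r + 1)) (c X) (c Y)) \<and>
          (reach (edges G') k (c X) (c Y) \<longrightarrow> reach H' k X Y))"
    if H': "H' \<subseteq> edges H" for H'
  proof -
    \<comment> \<open>All arcs inside branch sets stay; an arc between two of them stays only if the
      corresponding edge is in \<open>H'\<close>.\<close>
    define G' where "G' = \<lparr>pverts = pverts K,
      parcs = {(x, y) \<in> parcs K. \<exists>X\<in>?W. \<exists>Y\<in>?W. x \<in> X \<and> y \<in> Y \<and> (X = Y \<or> {X, Y} \<in> H')}\<rparr>"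
    have sub: "parcs G' \<subseteq> parcs K" "pverts G' = pverts K" by (auto simp: G'_def)
    have sym: "(y, x) \<in> parcs G'" if "(x, y) \<in> parcs G'" for x y
    proof -
      obtain X Y where "(x, y) \<in> parcs K" "X \<in> ?W" "Y \<in> ?W" "x \<in> X" "y \<in> Y" "X = Y \<or> {X, Y} \<in> H'"
        using \<open>(x, y) \<in> parcs G'\<close> unfolding G'_def by auto
      moreover from this have "Y = X \<or> {Y, X} \<in> H'" by (simp add: insert_commute eq_commute)
      ultimately show ?thesis using K.arcs_symmetric unfolding G'_def by auto
    qed
    have pg: "pair_graph G'"
    proof
      fix e assume "e \<in> parcs G'"
      then have "e \<in> parcs K" using sub by blast
      then show "fst e \<in> pverts G'" "snd e \<in> pverts G'" "fst e \<noteq> snd e"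
        using K.arc_fst_in_verts K.arc_snd_in_verts K.pair_no_loops sub(2) by auto
    next
      show "finite (pverts G')" "finite (parcs G')"
        using sub(2) K.pair_finite_verts finite_subset[OF sub(1) K.pair_finite_arcs] by simp_all
      show "symmetric (with_proj G')"
        unfolding symmetric_def by (auto intro: symI sym)
    qed
    interpret G': pair_graph G' by (fact pg)
    have "simple_subgraph G' K"
      unfolding simple_subgraph_def subgraph_def compatible_def
      using pg sub G'.wf_digraph K.wf_digraph by simp
    then have "simple_subgraph G' G" using K simple_subgraph_trans by blast
    moreover have "c X \<in> pverts G'" if "X \<in> ?W" for X
      using c(1)[OF that] WK[OF that] sub(2) by blast
    moreover have "reach (edges G') (k * (2 * r + 1)) (c X) (c Y)"
      if "X \<in> ?W" "reach H' k X Y" for X Y k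
    proof -
      have IG: "I \<subseteq> edges G'" unfolding I_def edges_def G'_def by auto
      have ball: "reach (edges G') r (c X) v" if "X \<in> ?W" "v \<in> X" for X v
        by (rule reach_mono[OF c(2)[OF that] IG order_refl])
      have "Y \<in> ?W \<and> reach (edges G') (k * (2 * r + 1)) (c X) (c Y)"
        using that(2)
      proof (induction k arbitrary: Y)
        case 0
        then show ?case using that(1) by simp
      next
        case (Suc k)
        then obtain Z where Z: "reach H' k X Z" "Z = Y \<or> {Z, Y} \<in> H'" by auto
        from Suc.IH[OF Z(1)] have ZW: "Z \<in> ?W"
          and XZ: "reach (edges G') (k * (2 * r + 1)) (c X) (c Z)" by auto
        show ?case
        proof (cases "Z = Y")
          case True
          then show ?thesis using ZW reach_mono[OF XZ order_refl, of "Suc k * (2 * r + 1)"] by simp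
        next
          case False
          then have ZY: "{Z, Y} \<in> H'" using Z(2) by blast
          then have ZYH: "{Z, Y} \<in> edges H" using H' by blast
          then have YW: "Y \<in> ?W"
            unfolding H edges_def parcs_contract by (auto simp: doubleton_eq_iff)
          obtain x y where xy: "x \<in> Z" "y \<in> Y" "{x, y} \<in> edges K"
            using edges_contract[OF K.pair_graph, of Z Y P] ZYH H by blast
          then have "(x, y) \<in> parcs G'"
            using ZY ZW YW doubleton_mem_edges[OF K.pair_graph] unfolding G'_def by auto
          then have "{x, y} \<in> edges G'" unfolding edges_def by blast
          from reach_trans[OF reach_trans[OF ball[OF ZW xy(1)] reach_edge[OF this]]
              reach_sym[OF ball[OF YW xy(2)]]]
          have "reach (edges G') (r + Suc 0 + r) (c Z) (c Y)" .
          from reach_trans[OF XZ this] have "reach (edges G') (Suc k * (2 * r + 1)) (c X) (c Y)"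
            by (simp add: algebra_simps)
          then show ?thesis using YW by blast
        qed
      qed
      then show ?thesis ..
    qed
    moreover have "reach H' k X Y"
      if "X \<in> ?W" "Y \<in> ?W" "reach (edges G') k (c X) (c Y)" for X Y k
    proof -
      \<comment> \<open>Generalized from centres to arbitrary end vertices \<open>z\<close> for the
        induction. Arcs inside a branch set project to standing still.\<close>
      have "reach H' k X Z" if "reach (edges G') k (c X) z" "Z \<in> ?W" "z \<in> Z" for z Z
        using that
      proof (induction k arbitrary: z Z)
        case 0
        then have "Z = X" using unique[of Z X "c X"] c(1) \<open>X \<in> ?W\<close> by auto
        then show ?case by simp
      next
        case (Suc k)
        then obtain y where y: "reach (edges G') k (c X) y" "y = z \<or> {y, z} \<in> edges G'" by auto
        show ?case
        proof (cases "y = z")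
          case True
          then have "reach H' k X Z" using Suc y(1) by blast
          then show ?thesis by auto
        next
          case False
          then have "(y, z) \<in> parcs G'" using y(2) doubleton_mem_edges[OF pg] by simp
          then obtain Y Z' where YZ: "Y \<in> ?W" "Z' \<in> ?W" "y \<in> Y" "z \<in> Z'" "Y = Z' \<or> {Y, Z'} \<in> H'"
            unfolding G'_def by auto
          then have "Z' = Z" using unique Suc.prems by blast
          moreover have "reach H' k X Y" using Suc.IH[OF y(1)] YZ by blast
          ultimately show ?thesis using YZ(5) by auto
        qed
      qed
      from this[OF that(3,2) c(1)[OF that(2)]] show ?thesis .
    qed
    ultimately show ?thesis by (intro exI[of _ G']) simp
  qed
  then show "\<exists>c. \<forall>H'\<subseteq>edges H. \<exists>G'. simple_subgraph G' G \<and> (\<forall>X\<in>pverts H. c X \<in> pverts G') \<and>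
       (\<forall>X\<in>pverts H. \<forall>Y\<in>pverts H. \<forall>k.
          (reach H' k X Y \<longrightarrow> reach (edges G') (k * (2 * r + 1)) (c X) (c Y)) \<and>
          (reach (edges G') k (c X) (c Y) \<longrightarrow> reach H' k X Y))"
    by (intro exI[of _ c] allI impI)
  show "finite (pverts H)" by (rule finW)
qed

text \<open>Out-degrees sum to the number of arcs, and an undirected edge carries at most two
  arcs.\<close>

lemma depth_minor_edges:
  assumes "depth_minor r H G"
  shows "average_degree H * real (card (pverts H)) \<le> 2 * real (card (edges H))"
    and "e \<in> edges H \<Longrightarrow> e \<subseteq> pverts H \<and> card e = 2"
proof -
  from assms obtain K P where K: "simple_subgraph K G" and H: "H = contract K P"
    unfolding depth_minor_def by metis
  have parcs: "(X, Y) \<in> parcs H \<Longrightarrow> X \<in> pverts H \<and> Y \<in> pverts H \<and> X \<noteq> Y" for X Y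
    unfolding H parcs_contract by auto
  then show "e \<in> edges H \<Longrightarrow> e \<subseteq> pverts H \<and> card e = 2"
    by (auto simp: edges_def)
  have fin: "finite (pverts H)"
    by (rule depth_minor_realization(1)[OF assms])
  have finP: "finite (parcs H)"
    by (rule finite_subset[of _ "pverts H \<times> pverts H"]) (use parcs fin in auto)
  have finE: "finite (edges H)"
    by (rule finite_subset[of _ "(\<lambda>(x, y). {x, y}) ` parcs H"]) (use finP in \<open>force simp: edges_def\<close>)+
  have "(\<Sum>v\<in>pverts H. out_degree (with_proj H) v) = card (\<Union>v\<in>pverts H. out_arcs (with_proj H) v)"
    unfolding out_degree_def
    by (rule card_UN_disjoint[symmetric]) (use fin finP in \<open>auto simp: out_arcs_def\<close>)
  also have "(\<Union>v\<in>pverts H. out_arcs (with_proj H) v) = parcs H"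
    using parcs by (auto simp: out_arcs_def)
  also have "card (parcs H) \<le> card (\<Union>e\<in>edges H. {p. {fst p, snd p} = e})"
  proof (rule card_mono)
    have "{p. {fst p, snd p} = e} \<subseteq> e \<times> e" for e :: "'a set set" by auto
    moreover have "finite e" if "e \<in> edges H" for e using that by (auto simp: edges_def)
    ultimately show "finite (\<Union>e\<in>edges H. {p. {fst p, snd p} = e})"
      using finE by (meson finite_SigmaI finite_UN_I finite_subset)
    show "parcs H \<subseteq> (\<Union>e\<in>edges H. {p. {fst p, snd p} = e})"
    proof
      fix p assume "p \<in> parcs H"
      then have "{fst p, snd p} \<in> edges H" unfolding edges_def by (cases p) auto
      then show "p \<in> (\<Union>e\<in>edges H. {p. {fst p, snd p} = e})" by simp
    qed
  qed
  also have "\<dots> \<le> (\<Sum>e\<in>edges H. card {p. {fst p, snd p} = e})"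
    by (rule card_UN_le[OF finE])
  also have "\<dots> \<le> (\<Sum>e\<in>edges H. 2)"
  proof (rule sum_mono)
    fix e assume "e \<in> edges H"
    then obtain x y where "e = {x, y}" by (auto simp: edges_def)
    then have "{p. {fst p, snd p} = e} \<subseteq> {(x, y), (y, x)}" by (auto simp: doubleton_eq_iff)
    then have "card {p. {fst p, snd p} = e} \<le> card {(x, y), (y, x)}" by (rule card_mono[rotated]) simp
    also have "\<dots> \<le> 2" using card_length[of "[(x, y), (y, x)]"] by simp
    finally show "card {p. {fst p, snd p} = e} \<le> 2" .
  qed
  finally have "(\<Sum>v\<in>pverts H. out_degree (with_proj H) v) \<le> 2 * card (edges H)" by simp
  then have "(\<Sum>v\<in>pverts H. real (out_degree (with_proj H) v)) \<le> 2 * real (card (edges H))"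
    unfolding of_nat_sum[symmetric] by linarith
  then show "average_degree H * real (card (pverts H)) \<le> 2 * real (card (edges H))"
    by (auto simp: average_degree_def)
qed

section \<open>From sketches to bounded average degree of minors\<close>

lemma depth_minor_average_degree_bounded:
  fixes F :: "nat pair_pre_digraph set" and \<alpha> :: real
  assumes mono: "monotone_class F" and "adt_sketchable \<alpha> F"
  shows "\<exists>b. \<forall>G\<in>F. \<forall>H. depth_minor r H G \<longrightarrow> average_degree H \<le> b"
proof -
  from assms(2)[unfolded adt_sketchable_def] obtain s where s: "\<forall>\<rho>. \<exists>D :: bool list \<Rightarrow> bool list \<Rightarrow> bool. \<forall>G\<in>F.
        \<exists>p :: (nat \<Rightarrow> bool list) pmf.
          set_pmf p \<subseteq> pverts G \<rightarrow>\<^sub>E {w. length w = s} \<and>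
          (\<forall>x\<in>pverts G. \<forall>y\<in>pverts G.
             (graph_dist G x y \<le> ereal (real \<rho>) \<longrightarrow>
                measure_pmf.prob p {sk. D (sk x) (sk y)} \<ge> 2 / 3) \<and>
             (graph_dist G x y > ereal (\<alpha> * real \<rho>) \<longrightarrow>
                measure_pmf.prob p {sk. \<not> D (sk x) (sk y)} \<ge> 2 / 3))"
    by (rule exE)
  \<comment> \<open>The stretch to be beaten: \<open>\<alpha>\<close> from the sketch times
    \<open>2 * r + 1\<close> from passing between \<open>H\<close> and \<open>G\<close>. The
    subdivision length \<open>l\<close> cancels, so \<open>t\<close> is known before
    \<open>H\<close>.\<close>
  define t where "t = nat \<lceil>\<alpha> * real (2 * r + 1)\<rceil>"
  have "0 < 39 * s + 3" by simp
  from dense_imp_uniform_subdivision[OF this, where ?'v = "nat set", of t]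
  obtain d where d: "\<forall>(V :: nat set set) E. finite V \<and> V \<noteq> {} \<and> (\<forall>e\<in>E. e \<subseteq> V \<and> card e = 2) \<and>
    d * card V \<le> card E \<longrightarrow> (\<exists>l U Q. simulates l E Q U \<and> U \<subseteq> V \<and> dense_girth (39 * s + 3) t U Q)"
    by (rule exE)
  \<comment> \<open>The bound is uniform over \<open>F\<close>, as \<open>d\<close> was obtained
    from \<open>s\<close> and \<open>t\<close> before \<open>G\<close> and \<open>H\<close> are
    fixed.\<close>
  have "average_degree H \<le> 2 * real d" if G: "G \<in> F" and minor: "depth_minor r H G" for G H
  proof (rule ccontr)
    assume large: "\<not> average_degree H \<le> 2 * real d"
    have fin: "finite (pverts H)" by (rule depth_minor_realization(1)[OF minor])
    obtain c where real: "\<forall>H'\<subseteq>edges H. \<exists>G'. simple_subgraph G' G \<and> (\<forall>X\<in>pverts H. c X \<in> pverts G') \<and>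
       (\<forall>X\<in>pverts H. \<forall>Y\<in>pverts H. \<forall>k.
          (reach H' k X Y \<longrightarrow> reach (edges G') (k * (2 * r + 1)) (c X) (c Y)) \<and>
          (reach (edges G') k (c X) (c Y) \<longrightarrow> reach H' k X Y))"
      using depth_minor_realization(2)[OF minor] by (rule exE)
    have "pverts H \<noteq> {}" using large by (auto simp: average_degree_def)
    moreover have "d * card (pverts H) \<le> card (edges H)"
    proof -
      have "2 * real d * real (card (pverts H)) \<le> average_degree H * real (card (pverts H))"
        using large by (intro mult_right_mono) auto
      also have "\<dots> \<le> 2 * real (card (edges H))" by (rule depth_minor_edges(1)[OF minor])
      finally have "real (d * card (pverts H)) \<le> real (card (edges H))" by simp
      then show ?thesis by (simp only: of_nat_le_iff)
    qed
    ultimately have "\<exists>l U Q. simulates l (edges H) Q U \<and> U \<subseteq> pverts H \<and> dense_girth (39 * s + 3) t U Q"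
      using d[rule_format, of "pverts H" "edges H"] fin depth_minor_edges(2)[OF minor] by simp
    then obtain l U Q where sim: "simulates l (edges H) Q U" and U: "U \<subseteq> pverts H"
      and Q: "dense_girth (39 * s + 3) t U Q"
      by (elim exE conjE)
    \<comment> \<open>This threshold depends on \<open>l\<close>, and so on \<open>H\<close>; that
      is allowed because \<open>s\<close> is fixed before the threshold.\<close>
    define \<rho> where "\<rho> = l * (2 * r + 1)"
    obtain D :: "bool list \<Rightarrow> bool list \<Rightarrow> bool" where D: "\<forall>G\<in>F. \<exists>p :: (nat \<Rightarrow> bool list) pmf.
          set_pmf p \<subseteq> pverts G \<rightarrow>\<^sub>E {w. length w = s} \<and>
          (\<forall>x\<in>pverts G. \<forall>y\<in>pverts G.
             (graph_dist G x y \<le> ereal (real \<rho>) \<longrightarrow>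
                measure_pmf.prob p {sk. D (sk x) (sk y)} \<ge> 2 / 3) \<and>
             (graph_dist G x y > ereal (\<alpha> * real \<rho>) \<longrightarrow>
                measure_pmf.prob p {sk. \<not> D (sk x) (sk y)} \<ge> 2 / 3))"
      using s[THEN spec, of \<rho>] by (rule exE)
    show False
    proof (rule no_edge_sketch[OF Q, of c D])
      fix Q' assume Q': "Q' \<subseteq> Q"
      from sim[unfolded simulates_def, rule_format, OF this]
      obtain H' where "H' \<subseteq> edges H"
        and H': "\<forall>x\<in>U. \<forall>y\<in>U. \<forall>k. reach Q' k x y \<longleftrightarrow> reach H' (l * k) x y"
        by (elim exE conjE)
      from real[rule_format, OF this(1)] obtain G' where G': "simple_subgraph G' G" "\<forall>X\<in>pverts H. c X \<in> pverts G'"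
        and G'H': "\<forall>X\<in>pverts H. \<forall>Y\<in>pverts H. \<forall>k.
          (reach H' k X Y \<longrightarrow> reach (edges G') (k * (2 * r + 1)) (c X) (c Y)) \<and>
          (reach (edges G') k (c X) (c Y) \<longrightarrow> reach H' k X Y)"
        by (elim exE conjE)
      have pg: "pair_graph G'" using G'(1) by (rule simple_subgraph_imp_pair_graph)
      have "G' \<in> F" using mono G G'(1) unfolding monotone_class_def by blast
      from bspec[OF D this] obtain p :: "(nat \<Rightarrow> bool list) pmf" where
        p1: "set_pmf p \<subseteq> pverts G' \<rightarrow>\<^sub>E {w. length w = s}" and
        p2: "\<forall>x\<in>pverts G'. \<forall>y\<in>pverts G'.
             (graph_dist G' x y \<le> ereal (real \<rho>) \<longrightarrow>
                measure_pmf.prob p {sk. D (sk x) (sk y)} \<ge> 2 / 3) \<and>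
             (graph_dist G' x y > ereal (\<alpha> * real \<rho>) \<longrightarrow>
                measure_pmf.prob p {sk. \<not> D (sk x) (sk y)} \<ge> 2 / 3)"
        by (elim exE conjE)
      have QU: "e \<subseteq> U" if "e \<in> Q" for e using Q that by (auto simp: dense_girth_def)
      show "\<exists>p :: (nat \<Rightarrow> bool list) pmf.
        (\<forall>sk\<in>set_pmf p. \<forall>x\<in>U. length (sk (c x)) = s) \<and>
        (\<forall>x y. {x, y} \<in> Q' \<longrightarrow> measure_pmf.prob p {sk. D (sk (c x)) (sk (c y))} \<ge> 2 / 3) \<and>
        (\<forall>x y. {x, y} \<in> Q - Q' \<longrightarrow> measure_pmf.prob p {sk. \<not> D (sk (c x)) (sk (c y))} \<ge> 2 / 3)"
      proof (intro exI[of _ p] conjI ballI allI impI)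
        show "length (sk (c x)) = s" if "sk \<in> set_pmf p" "x \<in> U" for sk x
          using p1 that U G'(2) by (auto dest!: subsetD[of _ _ sk] dest: PiE_mem)
      next
        fix x y assume xy: "{x, y} \<in> Q'"
        then have xyU: "x \<in> U" "y \<in> U" using QU Q' by auto
        then have xyH: "x \<in> pverts H" "y \<in> pverts H" using U by auto
        have "reach Q' 1 x y" using reach_edge[OF xy] by simp
        then have "reach H' l x y" using H' xyU by (metis mult_1_right)
        then have "reach (edges G') \<rho> (c x) (c y)" using G'H' xyH unfolding \<rho>_def by blast
        then have "graph_dist G' (c x) (c y) \<le> ereal (real \<rho>)"
          using G'(2) xyH by (intro graph_dist_le_of_reach[OF pg]) auto
        then show "measure_pmf.prob p {sk. D (sk (c x)) (sk (c y))} \<ge> 2 / 3"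
          using p2 G'(2) xyH by blast
      next
        fix x y assume xy: "{x, y} \<in> Q - Q'"
        then have xyU: "x \<in> U" "y \<in> U" using QU by auto
        then have xyH: "x \<in> pverts H" "y \<in> pverts H" using U by auto
        \<comment> \<open>A short walk in \<open>G'\<close> would project to \<open>H'\<close> with
          length at most \<open>l * t\<close>, hence to \<open>Q'\<close> with length at most
          \<open>t\<close>. It would avoid the missing edge \<open>{x, y}\<close>, against the girth
          of \<open>Q\<close>.\<close>
        have "\<not> graph_dist G' (c x) (c y) \<le> ereal (\<alpha> * real \<rho>)"
        proof
          assume "graph_dist G' (c x) (c y) \<le> ereal (\<alpha> * real \<rho>)"
          then have "reach (edges G') (nat \<lfloor>\<alpha> * real \<rho>\<rfloor>) (c x) (c y)"
            by (rule reach_of_graph_dist_le[OF pg])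
          then have H'xy: "reach H' (nat \<lfloor>\<alpha> * real \<rho>\<rfloor>) x y" using G'H' xyH by blast
          have "nat \<lfloor>\<alpha> * real \<rho>\<rfloor> \<le> l * t"
          proof -
            have "\<alpha> * real (2 * r + 1) \<le> real t" unfolding t_def by (rule real_nat_ceiling_ge)
            then have "real l * (\<alpha> * real (2 * r + 1)) \<le> real l * real t" by (rule mult_left_mono) simp
            then have "\<alpha> * real \<rho> \<le> real (l * t)" unfolding \<rho>_def of_nat_mult by (simp only: mult_ac)
            then show ?thesis by linarith
          qed
          from reach_mono[OF H'xy order_refl this] have "reach H' (l * t) x y" .
          then have "reach Q' t x y" using H' xyU by blast
          then have "reach (Q - {{x, y}}) t x y" by (rule reach_mono) (use xy Q' in auto)
          then show False using Q xy unfolding dense_girth_def girth_gt_def by blast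
        qed
        then have "graph_dist G' (c x) (c y) > ereal (\<alpha> * real \<rho>)" by simp
        then show "measure_pmf.prob p {sk. \<not> D (sk (c x)) (sk (c y))} \<ge> 2 / 3"
          using p2 G'(2) xyH by blast
      qed
    qed
  qed
  then show ?thesis by blast
qed

theorem theorem5p7:
  fixes F :: "nat pair_pre_digraph set" and \<alpha> :: real
  assumes "graph_class F"
    and "monotone_class F"
    and "\<alpha> > 1"
    and "adt_sketchable \<alpha> F"
  shows "bounded_expansion F"
  unfolding bounded_expansion_def
  using choice[OF allI[OF depth_minor_average_degree_bounded[OF assms(2,4)]]] .

end
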